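(* Let $n,m\ge1$, $G=\mathrm{GL}_{n+m}$, $M=\mathrm{GL}_n\times\mathrm{GL}_m$, and $b=(\tau_n^{d_1},\tau_m^{d_2})\in M(L)$ with $\gcd(d_1,n)=\gcd(d_2,m)=1$. Write $d_1=q_1n+p_1$ with $0<p_1<n$ and $d_2=q_2m+p_2$ with $0<p_2<m$, so $b=(t^{q_1}\tau_n^{p_1},t^{q_2}\tau_m^{p_2})$. Let \[ \mu_M=(\underbrace{1+q_1,\dots,1+q_1}_{p_1},q_1,\dots,q_1)\oplus(\underbrace{1+q_2,\dots,1+q_2}_{p_2},q_2,\dots,q_2) \] and let $\mu$ be its $G$-dominant rearrangement. Assume the Drinfeld case, i.e. $\dim X^M_{\mu_M}(b)=0$, with $p_1\in\{1,n-1\}$ and $p_2\in\{1,m-1\}$, and assume $q_1\neq q_2$. Then for every $(A,B)\bmod K\in X^M_{\mu_M}(b)$, the fiber $\beta^{-1}(A,B)\subset X^G_\mu(b)$ is zero-dimensional; indeed it consists of a single $K$-coset.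
   Context: $F$ is a non-Archimedean local field with uniformizer $t$; $L$ is the completion of its maximal unramified extension, with ring of integers $\mathcal O_L$, residue field $\bar\kappa$, Frobenius $\sigma$; $K=G(\mathcal O_L)$. $\tau_r\in\mathrm{GL}_r(L)$ has $1$'s on the superdiagonal, $t$ in the $(r,1)$ entry and $0$ elsewhere. For $\mu\in\mathbb Z^N$, $t^\mu=\mathrm{diag}(t^{\mu_i})$; $X^G_\mu(b)=\{gK: g^{-1}b\sigma(g)\in Kt^\mu K\}$, and $X^M_{\mu_M}(b)$ likewise for the block-diagonal Levi $M$ with $M(\mathcal O_L)$. The reduction-to-Levi map $\beta:X^G_\mu(b)\to X^M_{\mu_M}(b)$ comes from the Iwasawa decomposition $G(L)=M(L)N(L)K$ for the block-upper-triangular parabolic $P=MN$: $mnkK\mapsto mM(\mathcal O_L)$. *)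

theory Defs
  imports "HOL-Computational_Algebra.Polynomial" "Jordan_Normal_Form.Determinant"
begin

definition vball :: "('a::field \<Rightarrow> int) \<Rightarrow> int \<Rightarrow> 'a set" where
  "vball v N = {x. x = 0 \<or> N \<le> v x}"

definition val_ring :: "('a::field \<Rightarrow> int) \<Rightarrow> 'a set" where
  "val_ring v = vball v 0"

definition max_ideal :: "('a::field \<Rightarrow> int) \<Rightarrow> 'a set" where
  "max_ideal v = vball v 1"

definition discrete_valuation :: "('a::field \<Rightarrow> int) \<Rightarrow> bool" where
  "discrete_valuation v \<longleftrightarrow>
     (\<forall>x y. x \<noteq> 0 \<longrightarrow> y \<noteq> 0 \<longrightarrow> v (x * y) = v x + v y) \<and>
     (\<forall>x y. x \<noteq> 0 \<longrightarrow> y \<noteq> 0 \<longrightarrow> x + y \<noteq> 0 \<longrightarrow> min (v x) (v y) \<le> v (x + y))"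

definition val_complete :: "('a::field \<Rightarrow> int) \<Rightarrow> bool" where
  "val_complete v \<longleftrightarrow>
     (\<forall>s :: nat \<Rightarrow> 'a. (\<forall>N. \<exists>k. \<forall>i\<ge>k. \<forall>j\<ge>k. s i - s j \<in> vball v N) \<longrightarrow>
        (\<exists>l. \<forall>N. \<exists>k. \<forall>i\<ge>k. s i - l \<in> vball v N))"

definition residue_alg_closed :: "('a::field \<Rightarrow> int) \<Rightarrow> bool" where
  "residue_alg_closed v \<longleftrightarrow>
     (\<forall>p :: 'a poly. 1 \<le> degree p \<longrightarrow> lead_coeff p = 1 \<longrightarrow> (\<forall>i. coeff p i \<in> val_ring v) \<longrightarrow>
        (\<exists>a\<in>val_ring v. poly p a \<in> max_ideal v))"

text \<open>breve_setting v t sigma q: L (the type 'a) is complete for the discrete valuation v,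
  t is a uniformizer fixed by sigma, the residue field is algebraically closed of
  characteristic p, and sigma is an automorphism of L preserving v which lifts the
  q-Frobenius of the residue field (q a power of p). F is the fixed field of sigma.\<close>
definition breve_setting :: "('a::field \<Rightarrow> int) \<Rightarrow> 'a \<Rightarrow> ('a \<Rightarrow> 'a) \<Rightarrow> nat \<Rightarrow> bool" where
  "breve_setting v t \<sigma> q \<longleftrightarrow>
     discrete_valuation v \<and> val_complete v \<and> residue_alg_closed v \<and>
     t \<noteq> 0 \<and> v t = 1 \<and>
     bij \<sigma> \<and> (\<forall>x y. \<sigma> (x + y) = \<sigma> x + \<sigma> y) \<and> (\<forall>x y. \<sigma> (x * y) = \<sigma> x * \<sigma> y) \<and> \<sigma> 1 = 1 \<and>
     (\<forall>x. x \<noteq> 0 \<longrightarrow> v (\<sigma> x) = v x) \<and> \<sigma> t = t \<and>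
     (\<exists>p r. prime p \<and> 1 \<le> r \<and> q = p ^ r \<and> (of_nat p :: 'a) \<in> max_ideal v) \<and>
     (\<forall>x\<in>val_ring v. \<sigma> x - x ^ q \<in> max_ideal v)"

definition GLm :: "nat \<Rightarrow> 'a::field mat set" where
  "GLm N = {A \<in> carrier_mat N N. det A \<noteq> 0}"

definition Kgrp :: "('a::field \<Rightarrow> int) \<Rightarrow> nat \<Rightarrow> 'a mat set" where
  "Kgrp v N = {A \<in> carrier_mat N N. (\<forall>i<N. \<forall>j<N. A $$ (i, j) \<in> val_ring v) \<and>
                  det A \<noteq> 0 \<and> v (det A) = 0}"

definition tpow :: "'a::field \<Rightarrow> int list \<Rightarrow> 'a mat" where
  "tpow t \<mu> = mat (length \<mu>) (length \<mu>) (\<lambda>(i, j). if i = j then t powi (\<mu> ! i) else 0)"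

text \<open>g K lies in X_mu(b): g^{-1} b sigma(g) in K t^mu K (written without inverses).\<close>
definition ADLV :: "('a::field \<Rightarrow> int) \<Rightarrow> 'a \<Rightarrow> ('a \<Rightarrow> 'a) \<Rightarrow> nat \<Rightarrow> int list \<Rightarrow> 'a mat \<Rightarrow> 'a mat \<Rightarrow> bool" where
  "ADLV v t \<sigma> N \<mu> b g \<longleftrightarrow> g \<in> GLm N \<and>
     (\<exists>k1\<in>Kgrp v N. \<exists>k2\<in>Kgrp v N. b * map_mat \<sigma> g = g * (k1 * tpow t \<mu> * k2))"

definition tau :: "'a::field \<Rightarrow> nat \<Rightarrow> 'a mat" where
  "tau t r = mat r r (\<lambda>(i, j). if j = i + 1 then 1 else if i = r - 1 \<and> j = 0 then t else 0)"

text \<open>tau_r^d = t^q tau_r^p where d = q r + p, 0 \<le> p < r.\<close>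
definition bblock :: "'a::field \<Rightarrow> nat \<Rightarrow> int \<Rightarrow> 'a mat" where
  "bblock t r d = (t powi (d div int r)) \<cdot>\<^sub>m (tau t r ^\<^sub>m nat (d mod int r))"

definition muBlock :: "nat \<Rightarrow> int \<Rightarrow> int list" where
  "muBlock r d = replicate (nat (d mod int r)) (1 + d div int r) @
                 replicate (r - nat (d mod int r)) (d div int r)"

definition blockdiag :: "'a::field mat \<Rightarrow> 'a mat \<Rightarrow> 'a mat" where
  "blockdiag A B = four_block_mat A (0\<^sub>m (dim_row A) (dim_col B)) (0\<^sub>m (dim_row B) (dim_col A)) B"

definition unip :: "nat \<Rightarrow> nat \<Rightarrow> 'a::field mat \<Rightarrow> 'a mat" where
  "unip n m X = four_block_mat (1\<^sub>m n) X (0\<^sub>m m n) (1\<^sub>m m)"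

end

theory Submission
  imports Defs
begin

text \<open>Write \<open>C\<^sub>1 = A\<^sup>-\<^sup>1 b\<^sub>1 \<sigma>(A)\<close>, \<open>C\<^sub>2 = B\<^sup>-\<^sup>1 b\<^sub>2 \<sigma>(B)\<close>. The coset of \<open>diag(A, B) unip(X)\<close> lies in
  the variety iff the block matrix with rows \<open>(C\<^sub>1, Y)\<close>, \<open>(0, C\<^sub>2)\<close>, where \<open>Y = C\<^sub>1 \<sigma>(X) - X C\<^sub>2\<close>, has
  elementary divisors \<open>\<mu>\<close>. Suppose \<open>q\<^sub>1 > q\<^sub>2\<close>. Comparing ranks of \<open>t ^ (- q\<^sub>2)\<close> times this matrix modulo
  \<open>t\<close> gives \<open>Y = Z C\<^sub>2\<close> with \<open>Z\<close> integral, that is, \<open>X - \<phi>(X)\<close> is integral for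
  \<open>\<phi>(X) = C\<^sub>1 \<sigma>(X) C\<^sub>2\<^sup>-\<^sup>1\<close>. The map \<open>\<phi>\<close> preserves integral matrices since \<open>q\<^sub>1 \<ge> q\<^sub>2 + 1\<close>, and
  it is isoclinic of slope \<open>d\<^sub>1 / n - d\<^sub>2 / m > 0\<close>, hence topologically nilpotent; so \<open>X\<close> is integral and
  the coset is that of \<open>diag(A, B)\<close>. If \<open>q\<^sub>1 < q\<^sub>2\<close>, then dually \<open>Y = C\<^sub>1 Z\<close> and
  \<open>X \<mapsto> \<sigma>\<^sup>-\<^sup>1(C\<^sub>1\<^sup>-\<^sup>1 X C\<^sub>2)\<close> takes the place of \<open>\<phi>\<close>.\<close>

section \<open>Linear dependence by elimination\<close>

text \<open>Gaussian elimination, one column of \<open>Z\<close> per induction step. Arbitrary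
  finite index sets are allowed so that \<open>rank_argument\<close> can select rows and columns of
  a matrix.\<close>

lemma exists_nontrivial_combination:
  fixes f :: "'i \<Rightarrow> 'j \<Rightarrow> 'a::field"
  assumes "finite Z" "finite I" "card Z < card I"
  shows "\<exists>u. (\<exists>r\<in>I. u r \<noteq> 0) \<and> (\<forall>c\<in>Z. (\<Sum>r\<in>I. u r * f r c) = 0)"
  using assms
proof (induction Z arbitrary: I f rule: finite_induct)
  case empty
  then obtain i where "i \<in> I" by (metis card.empty card_gt_0_iff ex_in_conv)
  then show ?case by (intro exI[of _ "\<lambda>_. 1"]) auto
next
  case (insert z Z)
  show ?case
  proof (cases "\<forall>r\<in>I. f r z = 0")
    case True
    moreover obtain u where "\<exists>r\<in>I. u r \<noteq> 0" "\<forall>c\<in>Z. (\<Sum>r\<in>I. u r * f r c) = 0"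
      using insert.IH[of I f] insert.prems insert.hyps by auto
    ultimately show ?thesis by (intro exI[of _ u]) auto
  next
    case False
    then obtain s where s: "s \<in> I" "f s z \<noteq> 0" by blast
    \<comment> \<open>The rows after clearing column \<open>z\<close> with the pivot row
      \<open>s\<close>.\<close>
    define g where "g r c = f r c - f r z / f s z * f s c" for r c
    have "card Z < card (I - {s})"
      using insert.prems insert.hyps s by (simp add: card_Diff_singleton)
    then obtain u where u: "\<exists>r\<in>I - {s}. u r \<noteq> 0" "\<And>c. c \<in> Z \<Longrightarrow> (\<Sum>r\<in>I - {s}. u r * g r c) = 0"
      using insert.IH[of "I - {s}" g] insert.prems by auto
    \<comment> \<open>The coefficient of the pivot row collects the multiples of it that were
      subtracted, so \<open>w\<close> combines the rows \<open>f r\<close> exactly as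
      \<open>u\<close> combines the rows \<open>g r\<close>.\<close>
    define w where "w = u(s := - (\<Sum>r\<in>I - {s}. u r * (f r z / f s z)))"
    have split: "(\<Sum>r\<in>I. w r * f r c) = (\<Sum>r\<in>I - {s}. u r * g r c)" for c
    proof -
      have "(\<Sum>r\<in>I. w r * f r c) = w s * f s c + (\<Sum>r\<in>I - {s}. w r * f r c)"
        using s insert.prems by (simp add: sum.remove)
      also have "(\<Sum>r\<in>I - {s}. w r * f r c) = (\<Sum>r\<in>I - {s}. u r * f r c)"
        by (rule sum.cong) (auto simp: w_def)
      also have "w s * f s c = - (\<Sum>r\<in>I - {s}. u r * (f r z / f s z * f s c))"
        by (simp add: w_def sum_distrib_right mult.assoc)
      finally show ?thesis by (simp add: g_def sum_subtractf right_diff_distrib)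
    qed
    have "(\<Sum>r\<in>I. w r * f r c) = 0" if "c \<in> insert z Z" for c
    proof (cases "c = z")
      case True
      have "g r z = 0" for r using s by (simp add: g_def)
      then show ?thesis using split[of z] True by simp
    next
      case False
      then show ?thesis using that u(2) split by simp
    qed
    moreover have "\<exists>r\<in>I. w r \<noteq> 0" using u(1) by (auto simp: w_def)
    ultimately show ?thesis by blast
  qed
qed

section \<open>Matrix products and block matrices\<close>

declare index_mult_mat(1) [simp del]

lemma index_mult_mat_sum:
  assumes "X \<in> carrier_mat a b" "Y \<in> carrier_mat b c" "i < a" "j < c"
  shows "(X * Y) $$ (i, j) = (\<Sum>k<b. X $$ (i, k) * Y $$ (k, j))"
  using assms by (auto simp: index_mult_mat(1) scalar_prod_def atLeast0LessThan intro!: sum.cong)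

lemma mult_upper_block:
  assumes "A1 \<in> carrier_mat n n" "B1 \<in> carrier_mat n m" "D1 \<in> carrier_mat m m"
    "A2 \<in> carrier_mat n n" "B2 \<in> carrier_mat n m" "D2 \<in> carrier_mat m m"
  shows "four_block_mat A1 B1 (0\<^sub>m m n) D1 * four_block_mat A2 B2 (0\<^sub>m m n) D2 =
    four_block_mat (A1 * A2) (A1 * B2 + B1 * D2) (0\<^sub>m m n) (D1 * D2)"
  using assms by (subst mult_four_block_mat[of _ n n _ m _ m]) auto

lemma blockdiag_carrier [simp]:
  "A \<in> carrier_mat n n \<Longrightarrow> B \<in> carrier_mat m m \<Longrightarrow> blockdiag A B \<in> carrier_mat (n + m) (n + m)"
  by (simp add: blockdiag_def)

lemma unip_carrier [simp]: "X \<in> carrier_mat n m \<Longrightarrow> unip n m X \<in> carrier_mat (n + m) (n + m)"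
  by (simp add: unip_def)

lemma blockdiag_eq:
  "A \<in> carrier_mat n n \<Longrightarrow> B \<in> carrier_mat m m \<Longrightarrow>
   blockdiag A B = four_block_mat A (0\<^sub>m n m) (0\<^sub>m m n) B"
  by (auto simp: blockdiag_def)

lemma blockdiag_mult:
  assumes "A \<in> carrier_mat n n" "B \<in> carrier_mat m m" "C \<in> carrier_mat n n" "D \<in> carrier_mat m m"
  shows "blockdiag A B * blockdiag C D = blockdiag (A * C) (B * D)"
  using assms by (simp add: blockdiag_eq[of _ n _ m] mult_upper_block)

lemma blockdiag_one: "blockdiag (1\<^sub>m n) (1\<^sub>m m) = 1\<^sub>m (n + m)"
  by (simp add: blockdiag_def)

lemma invertible_matD:
  fixes A :: "'a::field mat"
  assumes "A \<in> carrier_mat n n" "det A \<noteq> 0"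
  obtains A' where "A' \<in> carrier_mat n n" "A * A' = 1\<^sub>m n" "A' * A = 1\<^sub>m n"
proof
  let ?A = "inverse (det A) \<cdot>\<^sub>m adj_mat A"
  note adj = adj_mat[OF assms(1)]
  show "?A \<in> carrier_mat n n" using adj by simp
  show "A * ?A = 1\<^sub>m n" "?A * A = 1\<^sub>m n"
    using adj assms by (auto simp: mult_smult_distrib[of _ n n] mult_smult_assoc_mat[of _ n n])
qed

section \<open>Diagonal matrices \<open>t^mu\<close> and permutation matrices\<close>

lemma tpow_carrier: "length \<mu> = n \<Longrightarrow> tpow t \<mu> \<in> carrier_mat n n"
  by (auto simp: tpow_def)

lemma dim_tpow [simp]: "dim_row (tpow t \<mu>) = length \<mu>" "dim_col (tpow t \<mu>) = length \<mu>"
  by (auto simp: tpow_def)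

lemma index_tpow [simp]:
  "i < length \<mu> \<Longrightarrow> j < length \<mu> \<Longrightarrow> tpow t \<mu> $$ (i, j) = (if i = j then t powi (\<mu> ! i) else 0)"
  by (simp add: tpow_def)

lemma index_mult_tpow:
  assumes "X \<in> carrier_mat a (length \<mu>)" "i < a" "j < length \<mu>"
  shows "(X * tpow t \<mu>) $$ (i, j) = X $$ (i, j) * t powi (\<mu> ! j)"
  using assms by (simp add: tpow_carrier index_mult_mat_sum[of _ a "length \<mu>" _ "length \<mu>"] if_distrib cong: if_cong)

lemma index_tpow_mult:
  assumes "X \<in> carrier_mat (length \<mu>) b" "i < length \<mu>" "j < b"
  shows "(tpow t \<mu> * X) $$ (i, j) = t powi (\<mu> ! i) * X $$ (i, j)"
  using assms
  by (simp add: tpow_carrier index_mult_mat_sum[of _ "length \<mu>" "length \<mu>" _ b] if_distrib[of "\<lambda>x. x * _"] cong: if_cong)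

lemma tpow_inverse:
  assumes "t \<noteq> 0"
  shows "tpow t \<mu> * tpow t (map uminus \<mu>) = 1\<^sub>m (length \<mu>)"
    "tpow t (map uminus \<mu>) * tpow t \<mu> = 1\<^sub>m (length \<mu>)"
  using assms by (auto intro!: eq_matI simp: tpow_carrier index_mult_tpow[of _ "length \<mu>"] index_tpow_mult[of _ _ "length \<mu>"]
      power_int_minus)

lemma tpow_append: "tpow t (\<mu> @ \<nu>) = blockdiag (tpow t \<mu>) (tpow t \<nu>)"
  by (rule eq_matI) (auto simp: tpow_def blockdiag_def nth_append)

text \<open>Row convention: row \<open>i\<close> of \<open>perm_mat n p * X\<close> is row
  \<open>p i\<close> of \<open>X\<close>, in agreement with \<open>permute_list\<close>.\<close>

definition perm_mat :: "nat \<Rightarrow> (nat \<Rightarrow> nat) \<Rightarrow> 'a::field mat" where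
  "perm_mat n p = mat n n (\<lambda>(i, j). if j = p i then 1 else 0)"

lemma perm_mat_carrier [simp]: "perm_mat n p \<in> carrier_mat n n"
  by (simp add: perm_mat_def)

lemma perm_mat_mult:
  assumes "p permutes {..<n}" "X \<in> carrier_mat n b" "i < n" "j < b"
  shows "(perm_mat n p * X) $$ (i, j) = X $$ (p i, j)"
proof -
  have "p i < n" using assms permutes_in_image[of p "{..<n}" i] by simp
  then have "(\<Sum>k<n. perm_mat n p $$ (i, k) * X $$ (k, j)) = X $$ (p i, j)"
    using assms by (simp add: perm_mat_def if_distrib[of "\<lambda>x. x * _"] cong: if_cong)
  then show ?thesis using assms by (subst index_mult_mat_sum[of _ n n _ b]) auto
qed

lemma perm_mat_inverse:
  assumes "p permutes {..<n}"
  shows "perm_mat n p * transpose_mat (perm_mat n p) = (1\<^sub>m n :: 'a::field mat)"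
    "transpose_mat (perm_mat n p) * perm_mat n p = (1\<^sub>m n :: 'a mat)"
proof -
  have *: "p i < n" if "i < n" for i using assms that permutes_in_image[of p "{..<n}" i] by simp
  have inj: "p i = p j \<longleftrightarrow> i = j" for i j using permutes_inj[OF assms] by (auto dest: injD)
  show 1: "perm_mat n p * transpose_mat (perm_mat n p) = (1\<^sub>m n :: 'a mat)"
  proof (rule eq_matI)
    fix i j assume "i < dim_row (1\<^sub>m n)" "j < dim_col (1\<^sub>m n)"
    then have ij: "i < n" "j < n" by auto
    have "(perm_mat n p * transpose_mat (perm_mat n p)) $$ (i, j) = transpose_mat (perm_mat n p :: 'a mat) $$ (p i, j)"
      using ij by (intro perm_mat_mult[OF assms, of _ n]) auto
    then show "(perm_mat n p * transpose_mat (perm_mat n p)) $$ (i, j) = (1\<^sub>m n :: 'a mat) $$ (i, j)"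
      using ij * by (simp add: perm_mat_def inj)
  qed (auto simp: perm_mat_def)
  show "transpose_mat (perm_mat n p) * perm_mat n p = (1\<^sub>m n :: 'a mat)"
    by (rule mat_mult_left_right_inverse[OF _ _ 1]) auto
qed

text \<open>Permutation matrices lie in K, so this makes the double coset \<open>K t^mu K\<close>
  depend only on the multiset of exponents. It links the concatenated Levi exponents to their
  dominant rearrangement.\<close>

lemma tpow_permute:
  assumes "mset \<mu> = mset \<nu>"
  obtains p where "p permutes {..<length \<nu>}"
    "tpow t \<mu> = perm_mat (length \<nu>) p * tpow t \<nu> * transpose_mat (perm_mat (length \<nu>) p)"
proof -
  obtain p where p: "p permutes {..<length \<nu>}" "permute_list p \<nu> = \<mu>"
    using mset_eq_permutation[OF assms] by blast
  let ?n = "length \<nu>" and ?P = "perm_mat (length \<nu>) p :: 'a mat"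
  have len: "length \<mu> = ?n" using p by auto
  have pn: "p i < ?n" if "i < ?n" for i using p that permutes_in_image[of p "{..<?n}" i] by simp
  have "tpow t \<mu> * ?P = ?P * tpow t \<nu>"
  proof (rule eq_matI)
    fix i j assume "i < dim_row (?P * tpow t \<nu>)" "j < dim_col (?P * tpow t \<nu>)"
    then have ij: "i < ?n" "j < ?n" by (auto simp: perm_mat_def tpow_def)
    then show "(tpow t \<mu> * ?P) $$ (i, j) = (?P * tpow t \<nu>) $$ (i, j)"
      using len p pn
      by (auto simp: index_tpow_mult[of _ _ ?n] index_mult_tpow[of _ ?n] perm_mat_def permute_list_nth)
  qed (auto simp: perm_mat_def tpow_def len)
  then have "tpow t \<mu> * ?P * transpose_mat ?P = ?P * tpow t \<nu> * transpose_mat ?P" by simp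
  also have "tpow t \<mu> * ?P * transpose_mat ?P = tpow t \<mu>"
    using len perm_mat_inverse(1)[OF p(1), where ?'a = 'a]
    by (simp add: tpow_carrier assoc_mult_mat[of _ ?n ?n _ ?n _ ?n])
  finally show ?thesis using that p by blast
qed

section \<open>Powers of \<open>tau_r\<close> and the isoclinic blocks\<close>

lemma tau_carrier [simp]: "tau t r \<in> carrier_mat r r"
  by (simp add: tau_def)

lemma dim_tau [simp]: "dim_row (tau t r) = r" "dim_col (tau t r) = r"
  by (auto simp: tau_def)

text \<open>\<open>tau t r\<close> is a cyclic shift that picks up a factor \<open>t\<close> on
  wrapping around. For \<open>k \<le> r\<close> no entry wraps twice, and at \<open>k = r\<close>
  all have wrapped, which leaves the scalar \<open>t\<close>.\<close>

lemma index_tau_pow: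
  assumes "k \<le> r" "i < r" "j < r"
  shows "(tau t r ^\<^sub>m k) $$ (i, j) = (if j = i + k then 1 else if j + r = i + k then t else 0)"
  using assms
proof (induction k arbitrary: j)
  case 0
  then show ?case by auto
next
  case (Suc k)
  have "(tau t r ^\<^sub>m Suc k) $$ (i, j) = (\<Sum>l<r. (tau t r ^\<^sub>m k) $$ (i, l) * tau t r $$ (l, j))"
    using Suc.prems by (simp add: index_mult_mat_sum[of _ r r _ r])
  \<comment> \<open>Column \<open>j\<close> of \<open>tau t r\<close> has a single nonzero entry, in
    row \<open>j - 1\<close>, or in row \<open>r - 1\<close> when \<open>j = 0\<close>.\<close>
  also have "\<dots> = (\<Sum>l<r. if l = (if j = 0 then r - 1 else j - 1)
      then (tau t r ^\<^sub>m k) $$ (i, l) * (if j = 0 then t else 1) else 0)"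
    using Suc.prems by (intro sum.cong) (auto simp: tau_def)
  also have "\<dots> = (tau t r ^\<^sub>m k) $$ (i, if j = 0 then r - 1 else j - 1) * (if j = 0 then t else 1)"
    using Suc.prems by (auto simp: sum.delta')
  also have "\<dots> = (if j = i + Suc k then 1 else if j + r = i + Suc k then t else 0)"
    using Suc.prems Suc.IH[of "if j = 0 then r - 1 else j - 1"] by auto
  finally show ?case .
qed

lemma tau_pow_self: "tau t r ^\<^sub>m r = t \<cdot>\<^sub>m 1\<^sub>m r"
  by (rule eq_matI) (auto simp: index_tau_pow)

lemma pow_mat_add:
  fixes A :: "'a::semiring_1 mat"
  assumes "A \<in> carrier_mat n n"
  shows "A ^\<^sub>m (k + l) = A ^\<^sub>m k * A ^\<^sub>m l"
  using assms by (induction l) (auto simp: assoc_mult_mat[of _ n n _ n _ n])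

lemma pow_mat_mult:
  fixes A :: "'a::semiring_1 mat"
  assumes "A \<in> carrier_mat n n"
  shows "A ^\<^sub>m (k * l) = (A ^\<^sub>m k) ^\<^sub>m l"
  using assms by (induction l) (simp_all add: add.commute[of k] pow_mat_add[of _ n])

lemma pow_mat_smult:
  fixes A :: "'a::field mat"
  assumes "A \<in> carrier_mat n n"
  shows "(c \<cdot>\<^sub>m A) ^\<^sub>m k = c ^ k \<cdot>\<^sub>m A ^\<^sub>m k"
proof (induction k)
  case 0
  then show ?case by (auto intro!: eq_matI)
next
  case (Suc k)
  have "(c ^ k \<cdot>\<^sub>m A ^\<^sub>m k) * (c \<cdot>\<^sub>m A) = c \<cdot>\<^sub>m (c ^ k \<cdot>\<^sub>m (A ^\<^sub>m k * A))"
    using assms by (simp add: mult_smult_distrib[of _ n n _ n] mult_smult_assoc_mat[of _ n n _ n])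
  then show ?case using Suc assms by (auto intro!: eq_matI)
qed

lemma pow_mat_scalar: "(c \<cdot>\<^sub>m 1\<^sub>m n :: 'a::field mat) ^\<^sub>m k = c ^ k \<cdot>\<^sub>m 1\<^sub>m n"
proof -
  have "(1\<^sub>m n :: 'a mat) ^\<^sub>m k = 1\<^sub>m n" by (induction k) auto
  then show ?thesis by (simp add: pow_mat_smult[of _ n])
qed

lemma bblock_carrier [simp]: "bblock t r d \<in> carrier_mat r r"
  by (simp add: bblock_def)

text \<open>The block is isoclinic of slope \<open>d / r\<close>: since \<open>tau_r^r = t\<close>,
  its power is the scalar with exponent \<open>(d div r) * r + d mod r\<close>.\<close>

lemma bblock_pow_self:
  assumes "t \<noteq> 0" "0 < r"
  shows "bblock t r d ^\<^sub>m r = t powi d \<cdot>\<^sub>m 1\<^sub>m r"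
proof -
  define p where "p = nat (d mod int r)"
  have d: "d = (d div int r) * int r + int p" using assms(2) by (simp add: p_def)
  have "(tau t r ^\<^sub>m p) ^\<^sub>m r = (tau t r ^\<^sub>m r) ^\<^sub>m p"
    using pow_mat_mult[of "tau t r" r p r] pow_mat_mult[of "tau t r" r r p] by (simp add: mult.commute)
  then have "bblock t r d ^\<^sub>m r = ((t powi (d div int r)) ^ r * t ^ p) \<cdot>\<^sub>m 1\<^sub>m r"
    by (auto simp: bblock_def p_def[symmetric] pow_mat_smult[of _ r] tau_pow_self pow_mat_scalar intro!: eq_matI)
  also have "(t powi (d div int r)) ^ r * t ^ p = t powi d"
    using assms(1) by (subst (2) d) (simp add: power_int_add power_int_mult)
  finally show ?thesis .
qed

text \<open>The inverse of a matrix \<open>b\<close> with \<open>b ^ r = t ^ d\<close> is \<open>t ^ (- d) b ^ (r - 1)\<close>, so it inherits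
  every property that is stable under powers and scalars fixed by the Frobenius.\<close>
definition bblock_inv :: "'a::field \<Rightarrow> nat \<Rightarrow> int \<Rightarrow> 'a mat" where
  "bblock_inv t r d = t powi (- d) \<cdot>\<^sub>m bblock t r d ^\<^sub>m (r - 1)"

lemma bblock_inv_carrier [simp]: "bblock_inv t r d \<in> carrier_mat r r"
  by (simp add: bblock_inv_def)

lemma bblock_inv:
  assumes "t \<noteq> 0" "0 < r"
  shows "bblock t r d * bblock_inv t r d = 1\<^sub>m r" "bblock_inv t r d * bblock t r d = 1\<^sub>m r"
proof -
  let ?b = "bblock t r d"
  have "?b ^\<^sub>m (r - 1) * ?b = ?b ^\<^sub>m r" using assms by (cases r) auto
  then show 1: "bblock_inv t r d * ?b = 1\<^sub>m r"
    using assms by (auto simp: bblock_inv_def mult_smult_assoc_mat[of _ r r _ r] bblock_pow_self power_int_minus intro!: eq_matI)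
  show "?b * bblock_inv t r d = 1\<^sub>m r" by (rule mat_mult_left_right_inverse[OF _ _ 1]) auto
qed

lemma bblock_inv_pow_self:
  assumes "t \<noteq> 0" "0 < r"
  shows "bblock_inv t r d ^\<^sub>m r = t powi (- d) \<cdot>\<^sub>m 1\<^sub>m r"
proof -
  let ?b = "bblock t r d"
  have "(?b ^\<^sub>m (r - 1)) ^\<^sub>m r = (?b ^\<^sub>m r) ^\<^sub>m (r - 1)"
    using pow_mat_mult[of ?b r "r - 1" r] pow_mat_mult[of ?b r r "r - 1"] by (simp add: mult.commute)
  then have "bblock_inv t r d ^\<^sub>m r = ((t powi (- d)) ^ r * (t powi d) ^ (r - 1)) \<cdot>\<^sub>m 1\<^sub>m r"
    using assms by (auto simp: bblock_inv_def pow_mat_smult[of _ r] bblock_pow_self pow_mat_scalar intro!: eq_matI)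
  also have "(t powi (- d)) ^ r * (t powi d) ^ (r - 1) = t powi (- d)"
    using assms by (cases r) (auto simp: power_int_minus field_simps)
  finally show ?thesis .
qed

lemma length_muBlock: "0 < r \<Longrightarrow> length (muBlock r d) = r"
proof -
  assume "0 < r"
  then have "nat (d mod int r) \<le> r" by (simp add: less_imp_le nat_le_iff)
  then show ?thesis by (simp add: muBlock_def)
qed

lemma set_muBlock: "set (muBlock r d) \<subseteq> {d div int r, d div int r + 1}"
  by (auto simp: muBlock_def)

section \<open>Valuation filtration on matrices and the group K\<close>

text \<open>For \<open>v t = 1\<close> this is the lattice \<open>t^N\<close> times the integral
  matrices. Tracking \<open>N\<close> replaces explicit division by powers of
  \<open>t\<close>.\<close>

definition vmat :: "('a::field \<Rightarrow> int) \<Rightarrow> int \<Rightarrow> nat \<Rightarrow> nat \<Rightarrow> 'a mat set" where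
  "vmat v N a b = {X \<in> carrier_mat a b. \<forall>i<a. \<forall>j<b. X $$ (i, j) \<in> vball v N}"

lemma vmat_carrier: "X \<in> vmat v N a b \<Longrightarrow> X \<in> carrier_mat a b"
  by (simp add: vmat_def)

lemma vmatD: "X \<in> vmat v N a b \<Longrightarrow> i < a \<Longrightarrow> j < b \<Longrightarrow> X $$ (i, j) \<in> vball v N"
  by (simp add: vmat_def)

lemma Kgrp_vmat: "k \<in> Kgrp v n \<Longrightarrow> k \<in> vmat v 0 n n"
  by (simp add: Kgrp_def vmat_def val_ring_def)

lemma Kgrp_carrier: "k \<in> Kgrp v n \<Longrightarrow> k \<in> carrier_mat n n"
  by (simp add: Kgrp_def)

lemma vmat_transpose: "X \<in> vmat v N a b \<Longrightarrow> transpose_mat X \<in> vmat v N b a"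
  by (auto simp: vmat_def)

lemma vball_mono: "N \<le> M \<Longrightarrow> vball v M \<subseteq> vball v N"
  by (auto simp: vball_def)

lemma vmat_mono: "X \<in> vmat v M a b \<Longrightarrow> N \<le> M \<Longrightarrow> X \<in> vmat v N a b"
  using vball_mono[of N M v] by (auto simp: vmat_def)

lemma zero_vball [simp]: "0 \<in> vball v N"
  by (simp add: vball_def)

locale uniformized_field =
  fixes v :: "'a::field \<Rightarrow> int" and t :: 'a
  assumes valuation: "discrete_valuation v"
    and t_nonzero: "t \<noteq> 0" and v_t: "v t = 1"
begin

lemma v_mult: "x \<noteq> 0 \<Longrightarrow> y \<noteq> 0 \<Longrightarrow> v (x * y) = v x + v y"
  using valuation by (simp add: discrete_valuation_def)

lemma v_one [simp]: "v 1 = 0"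
  using v_mult[of 1 1] by simp

lemma v_inverse: "x \<noteq> 0 \<Longrightarrow> v (inverse x) = - v x"
  using v_mult[of x "inverse x"] by simp

lemma v_minus [simp]: "v (- x) = v x"
proof (cases "x = 0")
  case False
  have "v (- 1) = 0" using v_mult[of "- 1" "- 1"] by simp
  then show ?thesis using v_mult[of "- 1" x] False by simp
qed simp

lemma v_power: "v (t ^ k) = int k"
  by (induction k) (simp_all add: v_mult t_nonzero v_t)

lemma v_powi [simp]: "v (t powi k) = k"
  using t_nonzero by (cases "k \<ge> 0") (simp_all add: power_int_def v_power v_inverse power_inverse)

lemma vball_add: "x \<in> vball v N \<Longrightarrow> y \<in> vball v N \<Longrightarrow> x + y \<in> vball v N"
  using valuation unfolding discrete_valuation_def vball_def
  by (smt (verit) add_0 add_cancel_left_right mem_Collect_eq min_def)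

lemma vball_minus: "x \<in> vball v N \<Longrightarrow> - x \<in> vball v N"
  by (auto simp: vball_def)

lemma vball_diff: "x \<in> vball v N \<Longrightarrow> y \<in> vball v N \<Longrightarrow> x - y \<in> vball v N"
  using vball_add[of x N "- y"] vball_minus by simp

lemma vball_mult: "x \<in> vball v N \<Longrightarrow> y \<in> vball v M \<Longrightarrow> x * y \<in> vball v (N + M)"
  by (cases "x = 0 \<or> y = 0") (auto simp: vball_def v_mult)

lemma vball_sum: "(\<And>i. i \<in> I \<Longrightarrow> f i \<in> vball v N) \<Longrightarrow> sum f I \<in> vball v N"
  by (induction I rule: infinite_finite_induct) (auto intro: vball_add)

lemma vball_prod: "(\<And>i. i \<in> I \<Longrightarrow> f i \<in> vball v 0) \<Longrightarrow> prod f I \<in> vball v 0"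
proof (induction I rule: infinite_finite_induct)
  case (insert x F)
  then show ?case using vball_mult[of "f x" 0 "prod f F" 0] by simp
qed (auto simp: vball_def)

lemma powi_vball [simp]: "t powi k \<in> vball v N \<longleftrightarrow> N \<le> k"
  using t_nonzero by (simp add: vball_def)

lemma vball_mult_cancel:
  assumes "x \<noteq> 0" "x * y \<in> vball v (v x + N)"
  shows "y \<in> vball v N"
  using assms by (cases "y = 0") (auto simp: vball_def v_mult)

lemma vmat_mult:
  assumes "X \<in> vmat v N a b" "Y \<in> vmat v M b c"
  shows "X * Y \<in> vmat v (N + M) a c"
proof -
  have "(X * Y) $$ (i, j) \<in> vball v (N + M)" if "i < a" "j < c" for i j
    using assms that by (subst index_mult_mat_sum[of _ a b _ c]) (auto simp: vmat_def intro!: vball_sum vball_mult)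
  then show ?thesis using assms by (auto simp: vmat_def)
qed

lemma vmat_mult0: "X \<in> vmat v 0 a b \<Longrightarrow> Y \<in> vmat v 0 b c \<Longrightarrow> X * Y \<in> vmat v 0 a c"
  using vmat_mult[of X 0 a b Y 0 c] by simp

lemma vmat_add: "X \<in> vmat v N a b \<Longrightarrow> Y \<in> vmat v N a b \<Longrightarrow> X + Y \<in> vmat v N a b"
  by (auto simp: vmat_def intro!: vball_add)

lemma vmat_uminus: "X \<in> vmat v N a b \<Longrightarrow> - X \<in> vmat v N a b"
  by (auto simp: vmat_def intro!: vball_minus)

lemma vmat_smult: "X \<in> vmat v N a b \<Longrightarrow> t powi k \<cdot>\<^sub>m X \<in> vmat v (k + N) a b"
  using powi_vball[of k k] by (auto simp: vmat_def simp del: powi_vball intro!: vball_mult)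

lemma tpow_vmat:
  assumes "\<And>x. x \<in> set \<mu> \<Longrightarrow> N \<le> x"
  shows "tpow t \<mu> \<in> vmat v N (length \<mu>) (length \<mu>)"
  using assms by (auto simp: vmat_def)

lemma bounded_mat:
  assumes "X \<in> carrier_mat a b"
  obtains N where "X \<in> vmat v N a b"
proof -
  \<comment> \<open>The inserted \<open>0\<close> keeps the set nonempty when the matrix has no
    entries.\<close>
  define S where "S = insert 0 ((\<lambda>(i, j). v (X $$ (i, j))) ` ({..<a} \<times> {..<b}))"
  have "finite S" by (simp add: S_def)
  then have "X \<in> vmat v (Min S) a b"
    using assms by (auto simp: vmat_def vball_def S_def intro!: Min_le)
  then show ?thesis using that by blast
qed

lemma det_vball:
  assumes "X \<in> vmat v 0 n n"
  shows "det X \<in> vball v 0"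
proof -
  have "signof p \<in> vball v 0" for p :: "nat \<Rightarrow> nat"
    by (auto simp: sign_def vball_def)
  then show ?thesis unfolding det_def'[OF vmat_carrier[OF assms]]
    using assms
    by (intro vball_sum) (auto simp: vmat_def permutes_in_image intro!: vball_mult[of _ 0 _ 0, simplified] vball_prod)
qed

text \<open>The two determinants are integral with product \<open>1\<close>, so both have valuation
  zero.\<close>

lemma KgrpI:
  assumes "k \<in> vmat v 0 n n" "k' \<in> vmat v 0 n n" "k * k' = 1\<^sub>m n"
  shows "k \<in> Kgrp v n"
proof -
  have d: "det k * det k' = 1"
    using assms det_mult[of k n k'] by (simp add: vmat_carrier)
  then have nz: "det k \<noteq> 0" "det k' \<noteq> 0" by auto
  then have "v (det k) + v (det k') = 0" using d v_mult by (metis v_one)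
  moreover have "v (det k) \<ge> 0" "v (det k') \<ge> 0"
    using nz det_vball assms by (auto simp: vball_def)
  ultimately show ?thesis using assms nz by (auto simp: Kgrp_def vmat_def val_ring_def)
qed

text \<open>The entries of the adjugate are minors up to sign, hence integral, and dividing by a
  unit determinant keeps them so.\<close>

lemma Kgrp_inverse:
  assumes "k \<in> Kgrp v n"
  obtains k' where "k' \<in> Kgrp v n" "k * k' = 1\<^sub>m n" "k' * k = 1\<^sub>m n"
proof -
  have kc: "k \<in> carrier_mat n n" and dk: "det k \<noteq> 0" "v (det k) = 0" using assms by (auto simp: Kgrp_def)
  let ?k = "inverse (det k) \<cdot>\<^sub>m adj_mat k"
  note adj = adj_mat[OF kc]
  have "cofactor k i j \<in> vball v 0" if "i < n" "j < n" for i j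
  proof -
    have "mat_delete k i j \<in> vmat v 0 (n - 1) (n - 1)"
      using Kgrp_vmat[OF assms] that by (auto simp: vmat_def mat_delete_def)
    moreover have "(- 1) ^ (i + j) \<in> vball v 0" by (cases "even (i + j)") (auto simp: vball_def)
    ultimately show ?thesis
      using det_vball vball_mult[of _ 0 _ 0] unfolding cofactor_def by (metis add_0)
  qed
  then have "adj_mat k \<in> vmat v 0 n n" using kc by (auto simp: adj_mat_def vmat_def)
  moreover have "inverse (det k) \<in> vball v 0" using dk by (simp add: vball_def v_inverse)
  ultimately have int: "?k \<in> vmat v 0 n n"
    using vball_mult[of "inverse (det k)" 0 _ 0] by (auto simp: vmat_def)
  have 1: "k * ?k = 1\<^sub>m n" "?k * k = 1\<^sub>m n"
    using adj kc dk by (auto simp: mult_smult_distrib[of _ n n] mult_smult_assoc_mat[of _ n n])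
  then have "?k \<in> Kgrp v n" using KgrpI[OF int Kgrp_vmat[OF assms]] by blast
  then show ?thesis using that 1 by blast
qed

lemma one_Kgrp [simp]: "1\<^sub>m n \<in> Kgrp v n"
  by (auto simp: Kgrp_def val_ring_def vball_def)

lemma Kgrp_mult:
  assumes "k \<in> Kgrp v n" "l \<in> Kgrp v n"
  shows "k * l \<in> Kgrp v n"
proof -
  have "k * l \<in> vmat v 0 n n" using assms Kgrp_vmat vmat_mult0 by blast
  moreover have "det (k * l) = det k * det l" using assms by (intro det_mult[of _ n]) (auto simp: Kgrp_carrier)
  ultimately show ?thesis using assms by (auto simp: Kgrp_def vmat_def val_ring_def v_mult)
qed

lemma upper_block_vmat:
  assumes "A \<in> vmat v N n n" "X \<in> vmat v N n m" "B \<in> vmat v N m m"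
  shows "four_block_mat A X (0\<^sub>m m n) B \<in> vmat v N (n + m) (n + m)"
  using assms by (auto simp: vmat_def)

lemma upper_block_Kgrp:
  assumes "A \<in> Kgrp v n" "X \<in> vmat v 0 n m" "B \<in> Kgrp v m"
  shows "four_block_mat A X (0\<^sub>m m n) B \<in> Kgrp v (n + m)"
proof -
  have "det (four_block_mat A X (0\<^sub>m m n) B) = det A * det B"
    using assms by (intro det_four_block_mat_lower_left_zero) (auto simp: Kgrp_carrier vmat_carrier)
  moreover have "four_block_mat A X (0\<^sub>m m n) B \<in> vmat v 0 (n + m) (n + m)"
    using assms by (intro upper_block_vmat Kgrp_vmat)
  ultimately show ?thesis using assms by (auto simp: Kgrp_def vmat_def val_ring_def v_mult)
qed

lemma blockdiag_Kgrp: "A \<in> Kgrp v n \<Longrightarrow> B \<in> Kgrp v m \<Longrightarrow> blockdiag A B \<in> Kgrp v (n + m)"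
  using upper_block_Kgrp[of A n "0\<^sub>m n m" m B]
  by (auto simp: blockdiag_eq[of _ n _ m] Kgrp_carrier vmat_def)

lemma unip_Kgrp: "X \<in> vmat v 0 n m \<Longrightarrow> unip n m X \<in> Kgrp v (n + m)"
  unfolding unip_def by (intro upper_block_Kgrp) auto

lemma perm_mat_Kgrp:
  assumes "p permutes {..<n}"
  shows "perm_mat n p \<in> Kgrp v n" "transpose_mat (perm_mat n p) \<in> Kgrp v n"
proof -
  have *: "perm_mat n p \<in> vmat v 0 n n" by (auto simp: vmat_def perm_mat_def vball_def)
  show "perm_mat n p \<in> Kgrp v n" "transpose_mat (perm_mat n p) \<in> Kgrp v n"
    using KgrpI[OF * vmat_transpose[OF *]] KgrpI[OF vmat_transpose[OF *] *] perm_mat_inverse[OF assms] by auto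
qed

section \<open>Rank modulo the maximal ideal\<close>

text \<open>Modulo the maximal ideal, \<open>t ^ (- e) D\<close> has rank at most \<open>card J\<close>, which is already attained on
  the rows \<open>J\<close>. So some \<open>u\<close> supported on \<open>insert i J\<close> has \<open>u D\<close> divisible by \<open>t ^ (e + 1)\<close>, and the
  columns in \<open>J\<close> force the coefficient \<open>u i\<close> to have minimal valuation.\<close>
lemma rank_argument:
  assumes k: "k \<in> vmat v 0 N N" and k': "k' \<in> vmat v 0 N N"
    and len: "length \<mu> = N" and ge: "\<And>x. x \<in> set \<mu> \<Longrightarrow> e \<le> x"
    and D: "D = k * tpow t \<mu> * k'"
    and J: "J \<subseteq> {..<N}" and card: "card {c. c < N \<and> \<mu> ! c = e} \<le> card J"
    and id: "\<And>r c. r \<in> J \<Longrightarrow> c \<in> J \<Longrightarrow> D $$ (r, c) = (if r = c then t powi e else 0)"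
    and i: "i < N" "i \<notin> J" and j: "j < N" and zero: "\<And>r. r \<in> J \<Longrightarrow> D $$ (r, j) = 0"
  shows "D $$ (i, j) \<in> vball v (e + 1)"
proof -
  note kc = vmat_carrier[OF k] vmat_carrier[OF k']
  have finJ: "finite J" using J finite_subset by blast
  define I where "I = insert i J"
  have I: "finite I" "I \<subseteq> {..<N}" using finJ i J by (auto simp: I_def)
  \<comment> \<open>The positions where the diagonal factor has valuation exactly \<open>e\<close>;
    all others contribute multiples of \<open>t^(e+1)\<close>.\<close>
  define Z where "Z = {c. c < N \<and> \<mu> ! c = e}"
  have "card Z < card I" using card finJ i by (simp add: I_def Z_def)
  then obtain u where u: "\<exists>r\<in>I. u r \<noteq> 0" "\<And>c. c \<in> Z \<Longrightarrow> (\<Sum>r\<in>I. u r * k $$ (r, c)) = 0"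
    using exists_nontrivial_combination[of Z I "\<lambda>r c. k $$ (r, c)"] I(1) by (auto simp: Z_def)
  \<comment> \<open>Instead of scaling \<open>u\<close> to be primitive, its minimal valuation
    \<open>w\<close> is carried along in the exponents.\<close>
  define w where "w = Min ((\<lambda>r. v (u r)) ` {r \<in> I. u r \<noteq> 0})"
  have fin: "finite ((\<lambda>r. v (u r)) ` {r \<in> I. u r \<noteq> 0})" using I by simp
  have uw: "u r \<in> vball v w" if "r \<in> I" for r
    using that fin by (auto simp: vball_def w_def intro!: Min_le)
  have "w \<in> (\<lambda>r. v (u r)) ` {r \<in> I. u r \<noteq> 0}"
    unfolding w_def using u(1) by (intro Min_in fin) auto
  then obtain r0 where r0: "r0 \<in> I" "u r0 \<noteq> 0" "v (u r0) = w" by auto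
  have Dsum: "D $$ (r, c) = (\<Sum>l<N. k $$ (r, l) * t powi (\<mu> ! l) * k' $$ (l, c))" if "r < N" "c < N" for r c
    unfolding D using that kc len
    by (subst index_mult_mat_sum[of _ N N _ N]) (auto simp: index_mult_tpow[of _ N] intro!: sum.cong)
  have uD: "(\<Sum>r\<in>I. u r * D $$ (r, c)) \<in> vball v (w + (e + 1))" if c: "c < N" for c
  proof -
    have "(\<Sum>r\<in>I. u r * D $$ (r, c)) =
        (\<Sum>r\<in>I. \<Sum>l<N. u r * k $$ (r, l) * (t powi (\<mu> ! l) * k' $$ (l, c)))"
      using I c by (intro sum.cong) (auto simp: Dsum sum_distrib_left mult.assoc)
    also have "\<dots> = (\<Sum>l<N. (\<Sum>r\<in>I. u r * k $$ (r, l)) * (t powi (\<mu> ! l) * k' $$ (l, c)))"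
      by (subst sum.swap) (simp add: sum_distrib_right)
    also have "\<dots> \<in> vball v (w + (e + 1))"
    proof (intro vball_sum)
      fix l assume "l \<in> {..<N}"
      then have l: "l < N" by simp
      show "(\<Sum>r\<in>I. u r * k $$ (r, l)) * (t powi (\<mu> ! l) * k' $$ (l, c)) \<in> vball v (w + (e + 1))"
      proof (cases "l \<in> Z")
        case False
        then have "\<mu> ! l \<noteq> e" "e \<le> \<mu> ! l" using l ge len by (auto simp: Z_def)
        then have "t powi (\<mu> ! l) * k' $$ (l, c) \<in> vball v ((e + 1) + 0)"
          using vmatD[OF k' l c] by (intro vball_mult) auto
        moreover have "(\<Sum>r\<in>I. u r * k $$ (r, l)) \<in> vball v (w + 0)"
          using uw I vmatD[OF k _ l] by (intro vball_sum vball_mult) auto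
        ultimately show ?thesis using vball_mult by fastforce
      qed (simp add: u)
    qed
    finally show ?thesis .
  qed
  have Dv: "D $$ (r, c) \<in> vball v e" if "r < N" "c < N" for r c
  proof -
    have "D \<in> vmat v (0 + e + 0) N N"
      unfolding D using k k' tpow_vmat[of \<mu> e] ge len by (intro vmat_mult) auto
    then show ?thesis using that by (simp add: vmatD)
  qed
  \<comment> \<open>Otherwise the minimum is attained at some \<open>r0\<close> in \<open>J\<close>.
    Column \<open>r0\<close> of the combination is then \<open>u r0\<close> times \<open>t^e\<close>
    plus a term of valuation at least \<open>w + e + 1\<close>, while the whole has at least that
    valuation, contradicting \<open>v (u r0) = w\<close>.\<close>
  have "u i \<noteq> 0 \<and> v (u i) = w"
  proof (rule ccontr)
    assume *: "\<not> (u i \<noteq> 0 \<and> v (u i) = w)"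
    then have r0J: "r0 \<in> J" using r0 by (auto simp: I_def)
    then have r0N: "r0 < N" using J by auto
    have ui: "u i \<in> vball v (w + 1)" using * uw[of i] by (auto simp: I_def vball_def)
    have "(\<Sum>r\<in>I. u r * D $$ (r, r0)) = u i * D $$ (i, r0) + (\<Sum>r\<in>J. u r * D $$ (r, r0))"
      using finJ i by (simp add: I_def)
    also have "(\<Sum>r\<in>J. u r * D $$ (r, r0)) = (\<Sum>r\<in>J. if r = r0 then u r * t powi e else 0)"
      using id r0J by (intro sum.cong) auto
    also have "\<dots> = u r0 * t powi e" using finJ r0J by simp
    finally have "u r0 * t powi e = (\<Sum>r\<in>I. u r * D $$ (r, r0)) - u i * D $$ (i, r0)" by simp
    also have "\<dots> \<in> vball v (w + (e + 1))"
      using uD[OF r0N] vball_mult[OF ui Dv[OF i(1) r0N]] by (intro vball_diff) (auto simp: algebra_simps)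
    finally show False using r0 t_nonzero by (auto simp: vball_def v_mult)
  qed
  moreover have "(\<Sum>r\<in>I. u r * D $$ (r, j)) = u i * D $$ (i, j)"
    using finJ i zero by (simp add: I_def)
  ultimately show ?thesis using uD[OF j] vball_mult_cancel[of "u i"] by auto
qed

end

section \<open>Divisibility of the corner block\<close>

lemma cancel_left_mat:
  fixes X :: "'a::field mat"
  assumes "P * Q = 1\<^sub>m a" "P \<in> carrier_mat a a" "Q \<in> carrier_mat a a" "X \<in> carrier_mat a b"
  shows "P * (Q * X) = X"
  using assms assoc_mult_mat[of P a a Q a X b] by simp

lemma card_nth_eq_count: "card {c. c < length xs \<and> xs ! c = e} = count (mset xs) e"
proof -
  have "count (mset xs) e = length (filter (\<lambda>x. x = e) xs)"
    by (induction xs) auto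
  then show ?thesis by (simp add: length_filter_conv_card)
qed

context uniformized_field
begin

text \<open>An upper bound on the elementary divisors bounds the denominators of the inverse, which
  is a product of \<open>t^(-nu)\<close> with elements of K on both sides.\<close>

lemma elementary_inverse:
  assumes l: "l \<in> Kgrp v m" and l': "l' \<in> Kgrp v m" and len: "length \<nu> = m"
    and le: "\<And>x. x \<in> set \<nu> \<Longrightarrow> x \<le> e" and C: "C = l * tpow t \<nu> * l'"
  obtains C' where "C' \<in> vmat v (- e) m m" "C * C' = 1\<^sub>m m" "C' * C = 1\<^sub>m m"
proof -
  obtain k where k: "k \<in> Kgrp v m" "l * k = 1\<^sub>m m" "k * l = 1\<^sub>m m" using Kgrp_inverse[OF l] .
  obtain k' where k': "k' \<in> Kgrp v m" "l' * k' = 1\<^sub>m m" "k' * l' = 1\<^sub>m m" using Kgrp_inverse[OF l'] .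
  note c = Kgrp_carrier[OF l] Kgrp_carrier[OF l'] Kgrp_carrier[OF k(1)] Kgrp_carrier[OF k'(1)]
    tpow_carrier[OF len, of t] tpow_carrier[of "map uminus \<nu>" m t]
  let ?C = "k' * tpow t (map uminus \<nu>) * k"
  have "tpow t (map uminus \<nu>) \<in> vmat v (- e) (length (map uminus \<nu>)) (length (map uminus \<nu>))"
    using le by (intro tpow_vmat) auto
  then have "tpow t (map uminus \<nu>) \<in> vmat v (- e) m m" using len by simp
  then have "?C \<in> vmat v (0 + - e + 0) m m"
    using k k' by (intro vmat_mult[where b = m] Kgrp_vmat) auto
  moreover have "C * ?C = 1\<^sub>m m"
    using c k k' len tpow_inverse[OF t_nonzero, of \<nu>] unfolding C
    by (simp add: assoc_mult_mat[of _ m m _ m _ m] cancel_left_mat[of _ _ m _ m])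
  ultimately show ?thesis
    using that[of ?C] c len mat_mult_left_right_inverse[of C m ?C] unfolding C by simp
qed

text \<open>The hypothesis \<open>count\<close> says that the lower block already accounts for every
  elementary divisor \<open>t^e\<close> of the whole matrix. Once the lower block is diagonal,
  divisibility of \<open>Y\<close> is checked column by column: exponent \<open>e\<close> is
  automatic from \<open>ge\<close>, and exponent \<open>e + 1\<close> comes from
  \<open>rank_argument\<close>.\<close>

lemma block_quotient_right:
  assumes eq: "four_block_mat C Y (0\<^sub>m m n) (l * tpow t \<nu> * l') = k * tpow t \<mu> * k'"
    and C: "C \<in> carrier_mat n n" and Y: "Y \<in> carrier_mat n m"
    and l: "l \<in> Kgrp v m" and l': "l' \<in> Kgrp v m"
    and k: "k \<in> vmat v 0 (n + m) (n + m)" and k': "k' \<in> vmat v 0 (n + m) (n + m)"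
    and len: "length \<nu> = m" "length \<mu> = n + m"
    and \<nu>: "set \<nu> \<subseteq> {e, e + 1}" and ge: "\<And>x. x \<in> set \<mu> \<Longrightarrow> e \<le> x"
    and count: "count (mset \<mu>) e = count (mset \<nu>) e"
  obtains Z where "Z \<in> vmat v 0 n m" "Y = Z * (l * tpow t \<nu> * l')"
proof -
  obtain j where j: "j \<in> Kgrp v m" "l * j = 1\<^sub>m m" "j * l = 1\<^sub>m m" using Kgrp_inverse[OF l] .
  obtain j' where j': "j' \<in> Kgrp v m" "l' * j' = 1\<^sub>m m" "j' * l' = 1\<^sub>m m" using Kgrp_inverse[OF l'] .
  note c = Kgrp_carrier[OF l] Kgrp_carrier[OF l'] Kgrp_carrier[OF j(1)] Kgrp_carrier[OF j'(1)]
    vmat_carrier[OF k] vmat_carrier[OF k'] C Y tpow_carrier[OF len(1), of t] tpow_carrier[OF len(2), of t]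
  \<comment> \<open>Multiplying by these two elements of K strips \<open>l\<close> and
    \<open>l'\<close>, so that the lower right block becomes \<open>t^nu\<close>.\<close>
  let ?E = "blockdiag (1\<^sub>m n) j" and ?E' = "blockdiag (1\<^sub>m n) j'" and ?N = "n + m"
  let ?D = "four_block_mat C (Y * j') (0\<^sub>m m n) (tpow t \<nu>)"
  have E: "?E \<in> vmat v 0 ?N ?N" "?E' \<in> vmat v 0 ?N ?N"
    using j j' by (auto intro!: Kgrp_vmat blockdiag_Kgrp)
  note cE = vmat_carrier[OF E(1)] vmat_carrier[OF E(2)]
  have "?D = ?E * four_block_mat C Y (0\<^sub>m m n) (l * tpow t \<nu> * l') * ?E'"
    using c j j' len
    by (simp add: blockdiag_eq[of _ n _ m] mult_upper_block assoc_mult_mat[of _ m m _ m _ m]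
        cancel_left_mat[of _ _ m _ m])
  then have D: "?D = (?E * k) * tpow t \<mu> * (k' * ?E')"
    unfolding eq using c cE len by (simp add: assoc_mult_mat[of _ ?N ?N _ ?N _ ?N])
  have K: "?E * k \<in> vmat v 0 ?N ?N" "k' * ?E' \<in> vmat v 0 ?N ?N" using E k k' vmat_mult0 by auto
  have "?D \<in> vmat v (0 + e + 0) ?N ?N"
    unfolding D using K tpow_vmat[of \<mu> e] ge len by (intro vmat_mult[where b = ?N]) auto
  then have De: "?D $$ (r, s) \<in> vball v e" if "r < ?N" "s < ?N" for r s using that vmatD by fastforce
  \<comment> \<open>The rows and columns of the lower block with exponent \<open>e\<close>, shifted
    past the \<open>n\<close> upper ones; \<open>?D\<close> restricted to them is \<open>t^e\<close>
    times the identity.\<close>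
  define J where "J = (\<lambda>c. n + c) ` {c. c < m \<and> \<nu> ! c = e}"
  have "card J = card {c. c < m \<and> \<nu> ! c = e}" unfolding J_def by (intro card_image) auto
  then have card: "card {c. c < ?N \<and> \<mu> ! c = e} \<le> card J"
    using card_nth_eq_count[of \<mu> e] card_nth_eq_count[of \<nu> e] count len by simp
  have JN: "J \<subseteq> {..<?N}" by (auto simp: J_def)
  have DJ: "?D $$ (n + r, n + s) = (if r = s then t powi (\<nu> ! r) else 0)" if "r < m" "s < m" for r s
    using that c len by simp
  have id: "?D $$ (r, s) = (if r = s then t powi e else 0)" if rs: "r \<in> J" "s \<in> J" for r s
  proof -
    obtain a where a: "r = n + a" "a < m" "\<nu> ! a = e" using rs(1) unfolding J_def by blast
    obtain b where b: "s = n + b" "b < m" using rs(2) unfolding J_def by blast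
    show ?thesis unfolding a(1) b(1) DJ[OF a(2) b(2)] a(3) by simp
  qed
  have Y': "(Y * j') $$ (i, s) \<in> vball v (\<nu> ! s)" if "i < n" "s < m" for i s
  proof -
    have entry: "?D $$ (i, n + s) = (Y * j') $$ (i, s)" using that c len by simp
    show ?thesis
    proof (cases "\<nu> ! s = e")
      case True
      then show ?thesis using De[of i "n + s"] entry that by simp
    next
      case False
      \<comment> \<open>Here \<open>De\<close> is one power of \<open>t\<close> short and
        \<open>rank_argument\<close> supplies it: column \<open>n + s\<close> vanishes on the rows
        \<open>J\<close>, as the lower block is diagonal and \<open>n + s\<close> is not in
        \<open>J\<close>.\<close>
      then have "\<nu> ! s = e + 1" using \<nu> len that by (metis empty_iff insert_iff nth_mem subsetD)
      moreover have "?D $$ (i, n + s) \<in> vball v (e + 1)"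
      proof (rule rank_argument[OF K len(2) ge D JN card id])
        show "i < ?N" "n + s < ?N" "i \<notin> J" using that by (auto simp: J_def)
        show "?D $$ (r, n + s) = 0" if r: "r \<in> J" for r
        proof -
          obtain a where a: "r = n + a" "a < m" "\<nu> ! a = e" using r unfolding J_def by blast
          show ?thesis unfolding a(1) DJ[OF a(2) \<open>s < m\<close>] using a(3) False by auto
        qed
      qed
      ultimately show ?thesis using entry by simp
    qed
  qed
  let ?T = "tpow t (map uminus \<nu>)"
  have "(Y * j' * ?T) $$ (i, s) \<in> vball v 0" if "i < n" "s < m" for i s
  proof -
    have "(Y * j' * ?T) $$ (i, s) = (Y * j') $$ (i, s) * t powi (- (\<nu> ! s))"
      using that c len by (subst index_mult_tpow[of _ n]) auto
    also have "\<dots> \<in> vball v (\<nu> ! s + - (\<nu> ! s))" using Y'[OF that] by (intro vball_mult) auto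
    finally show ?thesis by simp
  qed
  then have "Y * j' * ?T \<in> vmat v 0 n m" using c len by (auto simp: vmat_def)
  then have "Y * j' * ?T * j \<in> vmat v 0 n m" using j vmat_mult0 Kgrp_vmat by blast
  moreover have "Y = Y * j' * ?T * j * (l * tpow t \<nu> * l')"
    using c j j' len tpow_inverse[OF t_nonzero, of \<nu>] tpow_carrier[of "map uminus \<nu>" m t]
    by (simp add: assoc_mult_mat[of _ n m _ m _ m] assoc_mult_mat[of _ m m _ m _ m]
        cancel_left_mat[of _ _ m _ m])
  ultimately show ?thesis using that by blast
qed

text \<open>Mirror image of \<open>block_quotient_right\<close>: now the upper left block carries
  all elementary divisors \<open>t^e\<close>, and \<open>Y\<close> is divided row by row. Rows
  become columns by applying \<open>rank_argument\<close> to the transpose.\<close>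

lemma block_quotient_left:
  assumes eq: "four_block_mat (l * tpow t \<nu> * l') Y (0\<^sub>m m n) C = k * tpow t \<mu> * k'"
    and C: "C \<in> carrier_mat m m" and Y: "Y \<in> carrier_mat n m"
    and l: "l \<in> Kgrp v n" and l': "l' \<in> Kgrp v n"
    and k: "k \<in> vmat v 0 (n + m) (n + m)" and k': "k' \<in> vmat v 0 (n + m) (n + m)"
    and len: "length \<nu> = n" "length \<mu> = n + m"
    and \<nu>: "set \<nu> \<subseteq> {e, e + 1}" and ge: "\<And>x. x \<in> set \<mu> \<Longrightarrow> e \<le> x"
    and count: "count (mset \<mu>) e = count (mset \<nu>) e"
  obtains Z where "Z \<in> vmat v 0 n m" "Y = l * tpow t \<nu> * l' * Z"
proof -
  obtain j where j: "j \<in> Kgrp v n" "l * j = 1\<^sub>m n" "j * l = 1\<^sub>m n" using Kgrp_inverse[OF l] .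
  obtain j' where j': "j' \<in> Kgrp v n" "l' * j' = 1\<^sub>m n" "j' * l' = 1\<^sub>m n" using Kgrp_inverse[OF l'] .
  note c = Kgrp_carrier[OF l] Kgrp_carrier[OF l'] Kgrp_carrier[OF j(1)] Kgrp_carrier[OF j'(1)]
    vmat_carrier[OF k] vmat_carrier[OF k'] C Y tpow_carrier[OF len(1), of t] tpow_carrier[OF len(2), of t]
  let ?E = "blockdiag j (1\<^sub>m m)" and ?E' = "blockdiag j' (1\<^sub>m m)" and ?N = "n + m"
  let ?D = "four_block_mat (tpow t \<nu>) (j * Y) (0\<^sub>m m n) C"
  have E: "?E \<in> vmat v 0 ?N ?N" "?E' \<in> vmat v 0 ?N ?N"
    using j j' by (auto intro!: Kgrp_vmat blockdiag_Kgrp)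
  note cE = vmat_carrier[OF E(1)] vmat_carrier[OF E(2)]
  have "?D = ?E * four_block_mat (l * tpow t \<nu> * l') Y (0\<^sub>m m n) C * ?E'"
    using c j j' len
    by (simp add: blockdiag_eq[of _ n _ m] mult_upper_block assoc_mult_mat[of _ n n _ n _ n]
        cancel_left_mat[of _ _ n _ n])
  then have D: "?D = (?E * k) * tpow t \<mu> * (k' * ?E')"
    unfolding eq using c cE len by (simp add: assoc_mult_mat[of _ ?N ?N _ ?N _ ?N])
  have K: "?E * k \<in> vmat v 0 ?N ?N" "k' * ?E' \<in> vmat v 0 ?N ?N" using E k k' vmat_mult0 by auto
  have "?D \<in> vmat v (0 + e + 0) ?N ?N"
    unfolding D using K tpow_vmat[of \<mu> e] ge len by (intro vmat_mult[where b = ?N]) auto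
  then have De: "?D $$ (r, s) \<in> vball v e" if "r < ?N" "s < ?N" for r s using that vmatD by fastforce
  \<comment> \<open>As \<open>t^mu\<close> is symmetric, transposing the factorization merely
    exchanges and transposes the outer factors.\<close>
  have "transpose_mat (tpow t \<mu>) = tpow t \<mu>" by (rule eq_matI) auto
  then have "transpose_mat (F * tpow t \<mu> * F') = transpose_mat F' * tpow t \<mu> * transpose_mat F"
    if "F \<in> carrier_mat ?N ?N" "F' \<in> carrier_mat ?N ?N" for F F'
    using that c by (simp add: transpose_mult[of _ ?N ?N _ ?N] assoc_mult_mat[of _ ?N ?N _ ?N _ ?N])
  then have DT: "transpose_mat ?D = transpose_mat (k' * ?E') * tpow t \<mu> * transpose_mat (?E * k)"
    unfolding D using vmat_carrier[OF K(1)] vmat_carrier[OF K(2)] by blast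
  define J where "J = {c. c < n \<and> \<nu> ! c = e}"
  have card: "card {c. c < ?N \<and> \<mu> ! c = e} \<le> card J"
    using card_nth_eq_count[of \<mu> e] card_nth_eq_count[of \<nu> e] count len by (simp add: J_def)
  have JN: "J \<subseteq> {..<?N}" by (auto simp: J_def)
  have DJ: "transpose_mat ?D $$ (r, s) = (if r = s then t powi (\<nu> ! r) else 0)" if "r < n" "s < n" for r s
    using that c len by auto
  have id: "transpose_mat ?D $$ (r, s) = (if r = s then t powi e else 0)" if "r \<in> J" "s \<in> J" for r s
    using that DJ by (auto simp: J_def)
  have Y': "(j * Y) $$ (i, s) \<in> vball v (\<nu> ! i)" if "i < n" "s < m" for i s
  proof -
    have entry: "?D $$ (i, n + s) = (j * Y) $$ (i, s)" using that c len by simp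
    show ?thesis
    proof (cases "\<nu> ! i = e")
      case True
      then show ?thesis using De[of i "n + s"] entry that by simp
    next
      case False
      then have "\<nu> ! i = e + 1" using \<nu> len that by (metis empty_iff insert_iff nth_mem subsetD)
      moreover have "transpose_mat ?D $$ (n + s, i) \<in> vball v (e + 1)"
      proof (rule rank_argument[OF vmat_transpose[OF K(2)] vmat_transpose[OF K(1)] len(2) ge DT JN card id])
        show "n + s < ?N" "i < ?N" "n + s \<notin> J" using that by (auto simp: J_def)
        show "transpose_mat ?D $$ (r, i) = 0" if "r \<in> J" for r
          using that False DJ \<open>i < n\<close> by (auto simp: J_def)
      qed
      ultimately show ?thesis using entry that c len by simp
    qed
  qed
  let ?T = "tpow t (map uminus \<nu>)"
  have "(?T * (j * Y)) $$ (i, s) \<in> vball v 0" if "i < n" "s < m" for i s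
  proof -
    have "(?T * (j * Y)) $$ (i, s) = t powi (- (\<nu> ! i)) * (j * Y) $$ (i, s)"
      using that c len by (subst index_tpow_mult[of _ _ m]) auto
    also have "\<dots> \<in> vball v (- (\<nu> ! i) + \<nu> ! i)" using Y'[OF that] by (intro vball_mult) auto
    finally show ?thesis by simp
  qed
  then have "?T * (j * Y) \<in> vmat v 0 n m" using c len by (auto simp: vmat_def)
  then have "j' * (?T * (j * Y)) \<in> vmat v 0 n m" using j' vmat_mult0 Kgrp_vmat by blast
  moreover have "Y = l * tpow t \<nu> * l' * (j' * (?T * (j * Y)))"
    using c j j' len tpow_inverse[OF t_nonzero, of \<nu>] tpow_carrier[of "map uminus \<nu>" n t]
    by (simp add: assoc_mult_mat[of _ n n _ n _ m] assoc_mult_mat[of _ n n _ n _ n]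
        cancel_left_mat[of _ _ n _ m])
  ultimately show ?thesis using that by blast
qed

end

section \<open>Frobenius-semilinear contractions\<close>

text \<open>These properties of \<open>\<sigma>\<close> pass to its inverse, so every result of the
  locale is available for both.\<close>

locale frobenius_field = uniformized_field v t for v :: "'a::field \<Rightarrow> int" and t :: 'a +
  fixes \<sigma> :: "'a \<Rightarrow> 'a"
  assumes bij_\<sigma>: "bij \<sigma>" and \<sigma>_add: "\<sigma> (x + y) = \<sigma> x + \<sigma> y" and \<sigma>_mult: "\<sigma> (x * y) = \<sigma> x * \<sigma> y"
    and \<sigma>_one: "\<sigma> 1 = 1" and v_\<sigma>: "x \<noteq> 0 \<Longrightarrow> v (\<sigma> x) = v x" and \<sigma>_t: "\<sigma> t = t"
begin

sublocale \<sigma>: field_hom \<sigma>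
proof
  show "\<sigma> 0 = 0" using \<sigma>_add[of 0 0] by (metis add_0 add_cancel_right_right)
qed (auto simp: \<sigma>_add \<sigma>_mult \<sigma>_one)

text \<open>Serves the case \<open>q1 < q2\<close>, where the contraction is semilinear over the
  inverse of \<open>\<sigma>\<close>.\<close>

lemma inverse_frobenius: "frobenius_field v t (inv_into UNIV \<sigma>)"
proof
  have 1: "\<sigma> (inv_into UNIV \<sigma> x) = x" for x using bij_\<sigma> by (simp add: bij_is_surj surj_f_inv_f)
  have 2: "inv_into UNIV \<sigma> (\<sigma> x) = x" for x using bij_\<sigma> by (simp add: bij_is_inj)
  show "bij (inv_into UNIV \<sigma>)" using bij_\<sigma> by (rule bij_imp_bij_inv)
  show "inv_into UNIV \<sigma> (x + y) = inv_into UNIV \<sigma> x + inv_into UNIV \<sigma> y" "inv_into UNIV \<sigma> (x * y) = inv_into UNIV \<sigma> x * inv_into UNIV \<sigma> y" for x y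
    using 2[of "inv_into UNIV \<sigma> x + inv_into UNIV \<sigma> y"] 2[of "inv_into UNIV \<sigma> x * inv_into UNIV \<sigma> y"] by (simp_all add: 1 \<sigma>_add \<sigma>_mult)
  show "inv_into UNIV \<sigma> 1 = 1" "inv_into UNIV \<sigma> t = t" using 2[of 1] 2[of t] by (simp_all add: \<sigma>_t)
  show "v (inv_into UNIV \<sigma> x) = v x" if "x \<noteq> 0" for x
    using v_\<sigma>[of "inv_into UNIV \<sigma> x"] that 1[of x] by (metis \<sigma>.hom_zero)
qed

lemma map_vmat: "X \<in> vmat v N a b \<Longrightarrow> map_mat \<sigma> X \<in> vmat v N a b"
  using v_\<sigma> by (fastforce simp: vmat_def vball_def)

lemma map_Kgrp: "k \<in> Kgrp v n \<Longrightarrow> map_mat \<sigma> k \<in> Kgrp v n"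
  using map_vmat[of k 0 n n] v_\<sigma> by (auto simp: Kgrp_def vmat_def val_ring_def)

lemma map_mat_smult: "map_mat \<sigma> (c \<cdot>\<^sub>m X) = \<sigma> c \<cdot>\<^sub>m map_mat \<sigma> X"
  by (rule eq_matI) (auto simp: \<sigma>_mult)

lemma \<sigma>_powi: "\<sigma> (t powi k) = t powi k"
  by (simp add: power_int_def \<sigma>.hom_power \<sigma>.hom_inverse \<sigma>_t)

lemma map_bblock: "map_mat \<sigma> (bblock t r d) = bblock t r d"
proof -
  have "map_mat \<sigma> (tau t r) = tau t r" by (rule eq_matI) (auto simp: tau_def \<sigma>_t)
  then show ?thesis
    by (simp add: bblock_def map_mat_smult \<sigma>.mat_hom_pow[of _ r] \<sigma>_powi)
qed

lemma map_bblock_inv: "map_mat \<sigma> (bblock_inv t r d) = bblock_inv t r d"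
  by (simp add: bblock_inv_def map_mat_smult \<sigma>.mat_hom_pow[of _ r] \<sigma>_powi map_bblock)

text \<open>\<open>X \<mapsto> P \<sigma>(X) Q\<close> preserves integral matrices, and \<open>A X B\<^sup>-\<^sup>1\<close> turns it into
  \<open>W \<mapsto> b \<sigma>(W) c\<close>, whose iterates tend to zero since \<open>x + y > 0\<close>. Hence a matrix congruent to its
  image modulo integral matrices is itself integral.\<close>
lemma contraction_integral:
  assumes A: "A \<in> carrier_mat n n" "det A \<noteq> 0" and B: "B \<in> carrier_mat m m" "det B \<noteq> 0"
    and b: "b \<in> carrier_mat n n" "map_mat \<sigma> b = b" "b ^\<^sub>m N = t powi x \<cdot>\<^sub>m 1\<^sub>m n"
    and c: "c \<in> carrier_mat m m" "map_mat \<sigma> c = c" "c ^\<^sub>m N = t powi y \<cdot>\<^sub>m 1\<^sub>m m"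
    and P: "P \<in> vmat v h n n" "A * P = b * map_mat \<sigma> A"
    and Q: "Q \<in> vmat v (- h) m m" "map_mat \<sigma> B * Q = c * B"
    and xy: "0 < x + y"
    and X: "X \<in> carrier_mat n m" "X - P * map_mat \<sigma> X * Q \<in> vmat v 0 n m"
  shows "X \<in> vmat v 0 n m"
proof -
  obtain A' where A': "A' \<in> carrier_mat n n" "A * A' = 1\<^sub>m n" "A' * A = 1\<^sub>m n"
    using invertible_matD[OF A] .
  obtain B' where B': "B' \<in> carrier_mat m m" "B * B' = 1\<^sub>m m" "B' * B = 1\<^sub>m m"
    using invertible_matD[OF B] .
  note PQ = vmat_carrier[OF P(1)] vmat_carrier[OF Q(1)]
  note car = A(1) A'(1) B(1) B'(1) b(1) c(1) PQ
  note assocs = assoc_mult_mat[of _ n n _ n _ n] assoc_mult_mat[of _ n n _ n _ m]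
    assoc_mult_mat[of _ n n _ m _ m] assoc_mult_mat[of _ n m _ m _ m] assoc_mult_mat[of _ m m _ m _ m]
  define \<phi> where "\<phi> Y = P * map_mat \<sigma> Y * Q" for Y
  have \<phi>c: "\<phi> Y \<in> carrier_mat n m" if "Y \<in> carrier_mat n m" for Y using that PQ by (simp add: \<phi>_def)
  have \<phi>int: "\<phi> Y \<in> vmat v 0 n m" if "Y \<in> vmat v 0 n m" for Y
    using vmat_mult[OF vmat_mult[OF P(1) map_vmat[OF that]] Q(1)] by (simp add: \<phi>_def)
  have \<phi>diff: "\<phi> (Y - Z) = \<phi> Y - \<phi> Z" if "Y \<in> carrier_mat n m" "Z \<in> carrier_mat n m" for Y Z
  proof -
    have "map_mat \<sigma> (Y - Z) = map_mat \<sigma> Y - map_mat \<sigma> Z"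
      using that by (auto intro!: eq_matI simp: \<sigma>.hom_minus)
    then show ?thesis using that PQ
      by (simp add: \<phi>_def mult_minus_distrib_mat[of _ n n _ m] minus_mult_distrib_mat[of _ n m _ _ m])
  qed
  have itc: "(\<phi> ^^ k) X \<in> carrier_mat n m" for k by (induction k) (auto simp: X \<phi>c)
  \<comment> \<open>Telescoping: each new difference is \<open>X - \<phi> X\<close> plus the image
    under \<open>\<phi>\<close> of the previous difference, and \<open>\<phi>\<close> preserves
    integrality.\<close>
  have it: "X - (\<phi> ^^ k) X \<in> vmat v 0 n m" for k
  proof (induction k)
    case 0
    have "X - X = 0\<^sub>m n m" using X by auto
    then show ?case by (simp add: vmat_def)
  next
    case (Suc k)
    have "X - (\<phi> ^^ Suc k) X = (X - \<phi> X) + \<phi> (X - (\<phi> ^^ k) X)"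
      using X(1) itc[of k] \<phi>c[OF X(1)] \<phi>c[OF itc[of k]] by (simp add: \<phi>diff) (auto intro!: eq_matI)
    also have "\<dots> \<in> vmat v 0 n m"
      using X(2)[folded \<phi>_def] \<phi>int[OF Suc] by (intro vmat_add)
    finally show ?case .
  qed
  \<comment> \<open>The two intertwining relations for \<open>P\<close> and \<open>Q\<close> turn
    \<open>\<phi>\<close> into \<open>V \<mapsto> b \<sigma>(V) c\<close> after multiplication by
    \<open>A\<close> on the left and \<open>B'\<close> on the right.\<close>
  have step: "A * \<phi> Y * B' = b * map_mat \<sigma> (A * Y * B') * c" if Y: "Y \<in> carrier_mat n m" for Y
  proof -
    have BB: "map_mat \<sigma> B' * map_mat \<sigma> B = 1\<^sub>m m"
      using \<sigma>.mat_hom_mult[OF B'(1) B(1)] B'(3) by (simp add: \<sigma>.mat_hom_one)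
    have "Q = map_mat \<sigma> B' * (map_mat \<sigma> B * Q)" using cancel_left_mat[OF BB, of Q m] car by simp
    then have "Q * B' = map_mat \<sigma> B' * (c * B) * B'" by (simp add: Q(2))
    also have "\<dots> = map_mat \<sigma> B' * c" using car B' by (simp add: assocs)
    finally have QB: "Q * B' = map_mat \<sigma> B' * c" .
    have "A * \<phi> Y * B' = (A * P) * (map_mat \<sigma> Y * (Q * B'))"
      using car Y by (simp add: \<phi>_def assocs)
    also have "\<dots> = b * (map_mat \<sigma> A * map_mat \<sigma> Y * map_mat \<sigma> B') * c"
      using car Y by (simp add: P(2) QB assocs)
    also have "map_mat \<sigma> A * map_mat \<sigma> Y * map_mat \<sigma> B' = map_mat \<sigma> (A * Y * B')"
      using car Y by (simp add: \<sigma>.mat_hom_mult[of _ n m _ m] \<sigma>.mat_hom_mult[of _ n n _ m])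
    finally show ?thesis .
  qed
  define W where "W = A * X * B'"
  have Wc: "(map_mat \<sigma> ^^ k) W \<in> carrier_mat n m" for k by (induction k) (use car X in \<open>auto simp: W_def\<close>)
  have powc: "b ^\<^sub>m k \<in> carrier_mat n n" "c ^\<^sub>m k \<in> carrier_mat m m" for k
    using b(1) c(1) by auto
  have regroup: "b * (E * V * F) * c = (b * E) * V * (F * c)"
    if "E \<in> carrier_mat n n" "V \<in> carrier_mat n m" "F \<in> carrier_mat m m" for E V F
    using that b(1) c(1) by (simp add: assocs)
  have unconj: "A' * (A * V * B') * B = V" if "V \<in> carrier_mat n m" for V
    using that A(1) B(1) A' B' by (simp add: assocs cancel_left_mat[of _ _ n _ m])
  have scalars: "(\<alpha> \<cdot>\<^sub>m 1\<^sub>m n :: 'a mat) * V * (\<beta> \<cdot>\<^sub>m 1\<^sub>m m) = \<alpha> \<cdot>\<^sub>m (\<beta> \<cdot>\<^sub>m V)" if V: "V \<in> carrier_mat n m" for V \<alpha> \<beta>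
  proof -
    have "(\<alpha> \<cdot>\<^sub>m 1\<^sub>m n) * V = \<alpha> \<cdot>\<^sub>m V" using mult_smult_assoc_mat[of "1\<^sub>m n" n n V m \<alpha>] V by simp
    moreover have "\<alpha> \<cdot>\<^sub>m V * (\<beta> \<cdot>\<^sub>m 1\<^sub>m m) = \<beta> \<cdot>\<^sub>m (\<alpha> \<cdot>\<^sub>m V)"
      using mult_smult_distrib[of "\<alpha> \<cdot>\<^sub>m V" n m "1\<^sub>m m" m \<beta>] V by simp
    moreover have "\<beta> \<cdot>\<^sub>m (\<alpha> \<cdot>\<^sub>m V) = \<alpha> \<cdot>\<^sub>m (\<beta> \<cdot>\<^sub>m V)" by (rule eq_matI) auto
    ultimately show ?thesis by simp
  qed
  \<comment> \<open>Since \<open>\<sigma>\<close> fixes \<open>b\<close> and \<open>c\<close>,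
    iteration simply accumulates their powers around the iterates of \<open>\<sigma>\<close> on
    \<open>W\<close>.\<close>
  have conj: "A * (\<phi> ^^ k) X * B' = b ^\<^sub>m k * (map_mat \<sigma> ^^ k) W * c ^\<^sub>m k" for k
  proof (induction k)
    case 0
    have "dim_row b = n" "dim_row c = m" "W \<in> carrier_mat n m" using car Wc[of 0] by auto
    then show ?case by (simp add: W_def[symmetric])
  next
    case (Suc k)
    have bk: "b * b ^\<^sub>m k = b ^\<^sub>m Suc k" using pow_mat_add[OF b(1), of 1 k] b(1) by simp
    have "A * (\<phi> ^^ Suc k) X * B' = b * map_mat \<sigma> (b ^\<^sub>m k * (map_mat \<sigma> ^^ k) W * c ^\<^sub>m k) * c"
      using step[OF itc[of k]] Suc by simp
    also have "map_mat \<sigma> (b ^\<^sub>m k * (map_mat \<sigma> ^^ k) W * c ^\<^sub>m k) =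
        b ^\<^sub>m k * (map_mat \<sigma> ^^ Suc k) W * c ^\<^sub>m k"
      unfolding \<sigma>.mat_hom_mult[OF mult_carrier_mat[OF powc(1) Wc] powc(2)]
        \<sigma>.mat_hom_mult[OF powc(1) Wc] \<sigma>.mat_hom_pow[OF b(1)] \<sigma>.mat_hom_pow[OF c(1)] b(2) c(2) by simp
    also have "b * (b ^\<^sub>m k * (map_mat \<sigma> ^^ Suc k) W * c ^\<^sub>m k) * c =
        (b * b ^\<^sub>m k) * (map_mat \<sigma> ^^ Suc k) W * (c ^\<^sub>m k * c)"
      by (rule regroup[OF powc(1) Wc powc(2)])
    finally show ?case unfolding bk by simp
  qed
  obtain \<alpha> where \<alpha>: "A' \<in> vmat v \<alpha> n n" using bounded_mat[OF A'(1)] .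
  obtain \<beta> where \<beta>: "B \<in> vmat v \<beta> m m" using bounded_mat[OF B(1)] .
  obtain \<omega> where "W \<in> vmat v \<omega> n m" using bounded_mat[OF Wc[of 0]] by auto
  then have \<omega>: "(map_mat \<sigma> ^^ k) W \<in> vmat v \<omega> n m" for k by (induction k) (auto simp: map_vmat)
  \<comment> \<open>After \<open>N * s\<close> iterations both powers are scalar and contribute
    \<open>(x + y) * s \<ge> s\<close> to the valuation. This \<open>s\<close> outweighs any
    denominators of \<open>A'\<close>, \<open>B\<close> and \<open>W\<close>.\<close>
  define s where "s = nat (\<bar>\<alpha>\<bar> + \<bar>\<beta>\<bar> + \<bar>\<omega>\<bar>)"
  let ?k = "N * s"
  have pow: "(t powi z) ^ s = t powi (z * int s)" for z using t_nonzero by (simp add: power_int_mult)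
  have "A * (\<phi> ^^ ?k) X * B' = t powi (x * int s) \<cdot>\<^sub>m (t powi (y * int s) \<cdot>\<^sub>m (map_mat \<sigma> ^^ ?k) W)"
    unfolding conj pow_mat_mult[OF b(1)] pow_mat_mult[OF c(1)] b(3) c(3) pow_mat_scalar pow
    by (rule scalars[OF Wc])
  also have "\<dots> \<in> vmat v (x * int s + (y * int s + \<omega>)) n m" using \<omega> by (intro vmat_smult)
  finally have "A' * (A * (\<phi> ^^ ?k) X * B') * B \<in> vmat v (\<alpha> + (x * int s + (y * int s + \<omega>)) + \<beta>) n m"
    using vmat_mult[OF vmat_mult[OF \<alpha>] \<beta>] by blast
  then have "(\<phi> ^^ ?k) X \<in> vmat v (\<alpha> + (x * int s + (y * int s + \<omega>)) + \<beta>) n m"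
    by (simp only: unconj[OF itc])
  moreover have "0 \<le> \<alpha> + (x * int s + (y * int s + \<omega>)) + \<beta>"
  proof -
    have "1 * int s \<le> (x + y) * int s" using xy by (intro mult_right_mono) auto
    then have "int s \<le> x * int s + y * int s" by (simp add: distrib_right)
    moreover have "int s = \<bar>\<alpha>\<bar> + \<bar>\<beta>\<bar> + \<bar>\<omega>\<bar>" by (simp add: s_def)
    ultimately show ?thesis by linarith
  qed
  ultimately have "(\<phi> ^^ ?k) X \<in> vmat v 0 n m" by (rule vmat_mono)
  then have "(X - (\<phi> ^^ ?k) X) + (\<phi> ^^ ?k) X \<in> vmat v 0 n m" using it[of ?k] by (intro vmat_add)
  moreover have "(X - (\<phi> ^^ ?k) X) + (\<phi> ^^ ?k) X = X" using X(1) itc[of ?k] by (auto intro!: eq_matI)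
  ultimately show ?thesis by (simp only:)
qed

end

section \<open>Integrality of the unipotent part on the fiber\<close>

lemma mult_mat_regroup:
  fixes T :: "'a::semiring_0 mat"
  assumes "L \<in> carrier_mat n n" "P \<in> carrier_mat n n" "T \<in> carrier_mat n n" "Q \<in> carrier_mat n n" "R \<in> carrier_mat n n"
  shows "L * (P * T * Q) * R = (L * P) * T * (Q * R)"
  using assms by (simp add: assoc_mult_mat[of _ n n _ n _ n])

context frobenius_field
begin

lemma map_blockdiag:
  "A \<in> carrier_mat n n \<Longrightarrow> B \<in> carrier_mat m m \<Longrightarrow>
   map_mat \<sigma> (blockdiag A B) = blockdiag (map_mat \<sigma> A) (map_mat \<sigma> B)"
  by (rule eq_matI) (auto simp: blockdiag_def)

lemma map_unip: "X \<in> carrier_mat n m \<Longrightarrow> map_mat \<sigma> (unip n m X) = unip n m (map_mat \<sigma> X)"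
  by (rule eq_matI) (auto simp: unip_def)

lemma unip_uminus_mult:
  assumes "X \<in> carrier_mat n m"
  shows "unip n m (- X) * unip n m X = 1\<^sub>m (n + m)"
proof -
  have "X + - X = 0\<^sub>m n m" using assms by (intro eq_matI) auto
  then show ?thesis using assms by (simp add: unip_def mult_upper_block)
qed

text \<open>The matrix obtained is \<open>unip(-X) diag(C, D) unip(\<sigma>(X))\<close>, the twisted
  conjugate for the representative without \<open>k\<close>. Passing to it multiplies the outer
  factors by \<open>k\<close> and by the inverse of \<open>\<sigma>(k)\<close>, both in K.\<close>

lemma ADLV_unip_block:
  assumes A: "A \<in> carrier_mat n n" "det A \<noteq> 0" and B: "B \<in> carrier_mat m m" "det B \<noteq> 0"
    and C: "C \<in> carrier_mat n n" "b * map_mat \<sigma> A = A * C" "b \<in> carrier_mat n n"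
    and D: "D \<in> carrier_mat m m" "d * map_mat \<sigma> B = B * D" "d \<in> carrier_mat m m"
    and X: "X \<in> carrier_mat n m" and k: "k \<in> Kgrp v (n + m)" and len: "length \<mu> = n + m"
    and adlv: "ADLV v t \<sigma> (n + m) \<mu> (blockdiag b d) (blockdiag A B * unip n m X * k)"
  obtains k1 k2 where "k1 \<in> Kgrp v (n + m)" "k2 \<in> Kgrp v (n + m)"
    "four_block_mat C (C * map_mat \<sigma> X + (- X) * D) (0\<^sub>m m n) D = k1 * tpow t \<mu> * k2"
proof -
  obtain A' where A': "A' \<in> carrier_mat n n" "A * A' = 1\<^sub>m n" "A' * A = 1\<^sub>m n"
    using invertible_matD[OF A] .
  obtain B' where B': "B' \<in> carrier_mat m m" "B * B' = 1\<^sub>m m" "B' * B = 1\<^sub>m m"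
    using invertible_matD[OF B] .
  obtain j where j: "j \<in> Kgrp v (n + m)" "map_mat \<sigma> k * j = 1\<^sub>m (n + m)"
    using Kgrp_inverse[OF map_Kgrp[OF k]] by blast
  obtain k1 k2 where k12: "k1 \<in> Kgrp v (n + m)" "k2 \<in> Kgrp v (n + m)"
    and eq: "blockdiag b d * map_mat \<sigma> (blockdiag A B * unip n m X * k) =
      blockdiag A B * unip n m X * k * (k1 * tpow t \<mu> * k2)"
    using adlv unfolding ADLV_def by blast
  define h hi cc u su ui T bb sk N where "h = blockdiag A B" and "hi = blockdiag A' B'"
    and "cc = blockdiag C D" and "u = unip n m X" and "su = unip n m (map_mat \<sigma> X)"
    and "ui = unip n m (- X)" and "T = tpow t \<mu>" and "bb = blockdiag b d" and "sk = map_mat \<sigma> k"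
    and "N = n + m"
  note defs = h_def hi_def cc_def u_def su_def ui_def T_def bb_def sk_def N_def
  have car: "h \<in> carrier_mat N N" "hi \<in> carrier_mat N N" "cc \<in> carrier_mat N N" "u \<in> carrier_mat N N"
    "su \<in> carrier_mat N N" "ui \<in> carrier_mat N N" "T \<in> carrier_mat N N" "bb \<in> carrier_mat N N"
    "sk \<in> carrier_mat N N" "k \<in> carrier_mat N N" "k1 \<in> carrier_mat N N" "k2 \<in> carrier_mat N N"
    "j \<in> carrier_mat N N" "map_mat \<sigma> h \<in> carrier_mat N N"
    using A(1) B(1) A'(1) B'(1) C D X len k k12 j(1) by (auto simp: defs tpow_carrier Kgrp_carrier)
  have hih: "hi * h = 1\<^sub>m N"
    using A(1) B(1) A' B' by (simp add: defs blockdiag_mult[of _ n _ m] blockdiag_one)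
  have uiu: "ui * u = 1\<^sub>m N" using X by (simp add: defs unip_uminus_mult)
  have skj: "sk * j = 1\<^sub>m N" using j by (simp add: defs)
  have bh: "bb * map_mat \<sigma> h = h * cc"
    using A(1) B(1) C D by (simp add: defs map_blockdiag[of _ n _ m] blockdiag_mult[of _ n _ m])
  note assocs = assoc_mult_mat[of _ N N _ N _ N]
  have "map_mat \<sigma> (h * u * k) = map_mat \<sigma> h * su * sk"
    using car X by (simp add: \<sigma>.mat_hom_mult[of _ N N _ N] u_def su_def sk_def map_unip)
  then have "bb * (map_mat \<sigma> h * su * sk) = h * u * k * (k1 * T * k2)"
    using eq by (simp add: defs)
  moreover have "bb * (map_mat \<sigma> h * su * sk) = (bb * map_mat \<sigma> h) * su * sk"
    using car by (simp add: assocs)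
  ultimately have "h * (cc * su * sk) = h * (u * (k * (k1 * T * k2)))"
    unfolding bh using car by (simp add: assocs)
  then have "hi * (h * (cc * su * sk)) = hi * (h * (u * (k * (k1 * T * k2))))" by simp
  then have "cc * su * sk = u * (k * (k1 * T * k2))"
    using car by (simp add: cancel_left_mat[OF hih, of _ N])
  then have "ui * ((cc * su * sk) * j) = ui * (u * (k * (k1 * T * k2)) * j)" by simp
  moreover have "(cc * su * sk) * j = cc * su" using car skj by (simp add: assocs)
  moreover have "ui * (u * (k * (k1 * T * k2)) * j) = (k * k1) * T * (k2 * j)"
    using car by (simp add: assocs cancel_left_mat[OF uiu, of _ N])
  ultimately have "ui * (cc * su) = (k * k1) * T * (k2 * j)" by simp
  moreover have "ui * (cc * su) = four_block_mat C (C * map_mat \<sigma> X + (- X) * D) (0\<^sub>m m n) D"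
    using C(1) D(1) X by (simp add: ui_def cc_def su_def unip_def blockdiag_eq[of _ n _ m] mult_upper_block)
  ultimately show ?thesis
    using that[of "k * k1" "k2 * j"] Kgrp_mult k k12 j by (simp add: T_def)
qed

lemma fiber_integral:
  assumes n: "0 < n" and m: "0 < m"
    and p1: "0 < d1 mod int n" and p2: "0 < d2 mod int m"
    and qneq: "d1 div int n \<noteq> d2 div int m"
    and AX: "ADLV v t \<sigma> n (muBlock n d1) (bblock t n d1) A"
    and BX: "ADLV v t \<sigma> m (muBlock m d2) (bblock t m d2) B"
    and X: "X \<in> carrier_mat n m" and k: "k \<in> Kgrp v (n + m)"
    and GX: "ADLV v t \<sigma> (n + m) (rev (sort (muBlock n d1 @ muBlock m d2)))
      (blockdiag (bblock t n d1) (bblock t m d2)) (blockdiag A B * unip n m X * k)"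
  shows "X \<in> vmat v 0 n m"
proof -
  define \<nu>1 \<nu>2 \<mu> where "\<nu>1 = muBlock n d1" and "\<nu>2 = muBlock m d2"
    and "\<mu> = rev (sort (muBlock n d1 @ muBlock m d2))"
  define q1 q2 where "q1 = d1 div int n" and "q2 = d2 div int m"
  define b1 b2 where "b1 = bblock t n d1" and "b2 = bblock t m d2"
  define b1' b2' where "b1' = bblock_inv t n d1" and "b2' = bblock_inv t m d2"
  have bc: "b1 \<in> carrier_mat n n" "b1' \<in> carrier_mat n n" "b2 \<in> carrier_mat m m" "b2' \<in> carrier_mat m m"
    by (auto simp: b1_def b1'_def b2_def b2'_def)
  have binv: "b1' * b1 = 1\<^sub>m n" "b2' * b2 = 1\<^sub>m m"
    using bblock_inv[OF t_nonzero] n m by (auto simp: b1_def b1'_def b2_def b2'_def)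
  have len: "length \<nu>1 = n" "length \<nu>2 = m" "length \<mu> = n + m"
    using n m by (auto simp: \<nu>1_def \<nu>2_def \<mu>_def length_muBlock)
  have set\<nu>: "set \<nu>1 \<subseteq> {q1, q1 + 1}" "set \<nu>2 \<subseteq> {q2, q2 + 1}"
    unfolding \<nu>1_def \<nu>2_def q1_def q2_def by (rule set_muBlock)+
  have set\<mu>: "set \<mu> = set \<nu>1 \<union> set \<nu>2" by (simp add: \<mu>_def \<nu>1_def \<nu>2_def)
  have mset\<mu>: "mset \<mu> = mset \<nu>1 + mset \<nu>2" by (simp add: \<mu>_def \<nu>1_def \<nu>2_def)
  have A: "A \<in> carrier_mat n n" "det A \<noteq> 0" and B: "B \<in> carrier_mat m m" "det B \<noteq> 0"
    using AX BX by (auto simp: ADLV_def GLm_def)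
  obtain l1 l1' where l1: "l1 \<in> Kgrp v n" "l1' \<in> Kgrp v n"
    "b1 * map_mat \<sigma> A = A * (l1 * tpow t \<nu>1 * l1')"
    using AX by (auto simp: ADLV_def b1_def \<nu>1_def)
  obtain l2 l2' where l2: "l2 \<in> Kgrp v m" "l2' \<in> Kgrp v m"
    "b2 * map_mat \<sigma> B = B * (l2 * tpow t \<nu>2 * l2')"
    using BX by (auto simp: ADLV_def b2_def \<nu>2_def)
  define C1 C2 where C1: "C1 = l1 * tpow t \<nu>1 * l1'" and C2: "C2 = l2 * tpow t \<nu>2 * l2'"
  have "tpow t \<nu>1 \<in> vmat v q1 n n"
    unfolding len(1)[symmetric] using set\<nu>(1) by (intro tpow_vmat) auto
  then have "C1 \<in> vmat v (0 + q1 + 0) n n"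
    unfolding C1 using l1 by (intro vmat_mult[where b = n] Kgrp_vmat) auto
  then have C1v: "C1 \<in> vmat v q1 n n" by simp
  have "tpow t \<nu>2 \<in> vmat v q2 m m"
    unfolding len(2)[symmetric] using set\<nu>(2) by (intro tpow_vmat) auto
  then have "C2 \<in> vmat v (0 + q2 + 0) m m"
    unfolding C2 using l2 by (intro vmat_mult[where b = m] Kgrp_vmat) auto
  then have C2v: "C2 \<in> vmat v q2 m m" by simp
  note C1c = vmat_carrier[OF C1v] and C2c = vmat_carrier[OF C2v]
  have "ADLV v t \<sigma> (n + m) \<mu> (blockdiag b1 b2) (blockdiag A B * unip n m X * k)"
    using GX by (simp add: \<mu>_def b1_def b2_def)
  then obtain k1 k2 where k12: "k1 \<in> vmat v 0 (n + m) (n + m)" "k2 \<in> vmat v 0 (n + m) (n + m)"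
    and eq: "four_block_mat C1 (C1 * map_mat \<sigma> X + (- X) * C2) (0\<^sub>m m n) C2 = k1 * tpow t \<mu> * k2"
    using ADLV_unip_block[OF A B C1c l1(3)[folded C1] bc(1) C2c l2(3)[folded C2] bc(3) X k len(3)] Kgrp_vmat
    by metis
  let ?Y = "C1 * map_mat \<sigma> X + (- X) * C2"
  have Yc: "?Y \<in> carrier_mat n m" using C1c C2c X by auto
  have pw: "(t powi z) ^ r = t powi (z * int r)" for z r using t_nonzero by (simp add: power_int_mult)
  \<comment> \<open>The common exponent \<open>n * m\<close> makes the powers of both blocks scalar
    at once, bringing the slopes to a common denominator: \<open>d1 * m\<close> against
    \<open>d2 * n\<close>.\<close>
  have pow1: "b1 ^\<^sub>m (n * m) = t powi (d1 * int m) \<cdot>\<^sub>m 1\<^sub>m n" "b1' ^\<^sub>m (n * m) = t powi (- d1 * int m) \<cdot>\<^sub>m 1\<^sub>m n"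
    using bc n t_nonzero
    by (simp_all add: pow_mat_mult[of _ n] b1_def b1'_def bblock_pow_self bblock_inv_pow_self pow_mat_scalar pw)
  have "b2 ^\<^sub>m (m * n) = t powi (d2 * int n) \<cdot>\<^sub>m 1\<^sub>m m" "b2' ^\<^sub>m (m * n) = t powi (- d2 * int n) \<cdot>\<^sub>m 1\<^sub>m m"
    using bc m t_nonzero
    by (simp_all add: pow_mat_mult[of _ m] b2_def b2'_def bblock_pow_self bblock_inv_pow_self pow_mat_scalar pw)
  then have pow2: "b2 ^\<^sub>m (n * m) = t powi (d2 * int n) \<cdot>\<^sub>m 1\<^sub>m m" "b2' ^\<^sub>m (n * m) = t powi (- d2 * int n) \<cdot>\<^sub>m 1\<^sub>m m"
    by (simp_all add: mult.commute)
  \<comment> \<open>The slopes lie strictly between consecutive integers because the residues are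
    positive.\<close>
  have d1: "q1 * int n < d1" "d1 < (q1 + 1) * int n"
    using p1 n div_mult_mod_eq[of d1 "int n"] pos_mod_bound[of "int n" d1] unfolding q1_def distrib_right
    by linarith+
  have d2: "q2 * int m < d2" "d2 < (q2 + 1) * int m"
    using p2 m div_mult_mod_eq[of d2 "int m"] pos_mod_bound[of "int m" d2] unfolding q2_def distrib_right
    by linarith+
  consider "q2 < q1" | "q1 < q2" using qneq unfolding q1_def q2_def by (meson linorder_neqE)
  then show ?thesis
  proof cases
    case 1
    \<comment> \<open>All exponents in \<open>\<nu>1\<close> exceed \<open>q2\<close>, so those
      equal to \<open>q2\<close> in \<open>\<mu>\<close> come from the lower block.\<close>
    have "count (mset \<nu>1) q2 = 0" using set\<nu>(1) 1 by (auto simp: count_eq_zero_iff)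
    then have cnt: "count (mset \<mu>) q2 = count (mset \<nu>2) q2" by (simp add: mset\<mu>)
    have ge: "q2 \<le> x" if "x \<in> set \<mu>" for x using that 1 set\<nu> by (auto simp: set\<mu>)
    have le: "x \<le> q2 + 1" if "x \<in> set \<nu>2" for x using that set\<nu> by auto
    have eq2: "four_block_mat C1 ?Y (0\<^sub>m m n) (l2 * tpow t \<nu>2 * l2') = k1 * tpow t \<mu> * k2"
      unfolding C2[symmetric] by (rule eq)
    obtain Z where Z: "Z \<in> vmat v 0 n m" "?Y = Z * C2"
      using block_quotient_right[OF eq2 C1c Yc l2(1,2) k12 len(2,3) set\<nu>(2) ge cnt] unfolding C2[symmetric] by blast
    obtain C2' where C2': "C2' \<in> vmat v (- (q2 + 1)) m m" "C2 * C2' = 1\<^sub>m m" "C2' * C2 = 1\<^sub>m m"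
      using elementary_inverse[OF l2(1,2) len(2) le C2] by blast
    note C2'c = vmat_carrier[OF C2'(1)] and Zc = vmat_carrier[OF Z(1)]
    let ?V = "C1 * map_mat \<sigma> X * C2'"
    \<comment> \<open>Dividing \<open>?Y = Z * C2\<close> by \<open>C2\<close> on the right shows
      that \<open>X\<close> differs from its image by the integral matrix
      \<open>- Z\<close>.\<close>
    have "?Y * C2' = ?V + (- X) * C2 * C2'"
      using C1c C2c C2'c X by (intro add_mult_distrib_mat[of _ n m]) auto
    also have "(- X) * C2 * C2' = - X"
      using C2c C2'c X C2' assoc_mult_mat[of "- X" n m C2 m C2' m] by simp
    finally have "Z = ?V + - X"
      unfolding Z(2) using Zc C2c C2'c C2' assoc_mult_mat[of Z n m C2 m C2' m] by simp
    then have "X - ?V = - Z"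
      using C1c C2'c X by (intro eq_matI) auto
    then have XV: "X - ?V \<in> vmat v 0 n m" using vmat_uminus[OF Z(1)] by simp
    have "b2' * B = b2' * (B * (C2 * C2'))" using C2' B by simp
    also have "\<dots> = b2' * (B * C2 * C2')" using B(1) C2c C2'c by (simp add: assoc_mult_mat[of _ m m _ m _ m])
    also have "B * C2 = b2 * map_mat \<sigma> B" using l2(3) by (simp add: C2)
    also have "b2' * (b2 * map_mat \<sigma> B * C2') = map_mat \<sigma> B * C2'"
      using B(1) bc C2'c by (simp add: assoc_mult_mat[of _ m m _ m _ m] cancel_left_mat[OF binv(2), of _ m])
    finally have QB: "map_mat \<sigma> B * C2' = b2' * B" by simp
    \<comment> \<open>The integer \<open>q2 + 1\<close> separates the slopes:
      \<open>d2 / m < q2 + 1 \<le> q1 < d1 / n\<close>.\<close>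
    have "(q2 + 1) * int n * int m \<le> q1 * int n * int m" using 1 by (intro mult_right_mono) auto
    moreover have "q1 * int n * int m < d1 * int m" using d1(1) m by (intro mult_strict_right_mono) auto
    moreover have "d2 * int n < (q2 + 1) * int m * int n" using d2(2) n by (intro mult_strict_right_mono) auto
    ultimately have pos: "0 < d1 * int m + - d2 * int n" by (simp add: algebra_simps)
    \<comment> \<open>The contraction lemma is used with \<open>h = q2 + 1\<close>:
      \<open>C1\<close> is divisible by \<open>t^q1\<close>, hence by \<open>t^h\<close>, while the
      inverse of \<open>C2\<close> has denominator at most \<open>t^h\<close>.\<close>
    show ?thesis
      using contraction_integral[OF A B bc(1) _ pow1(1) bc(4) _ pow2(2) _ _ C2'(1) QB pos X XV]
        vmat_mono[OF C1v, of "q2 + 1"] 1 l1(3)[folded C1] map_bblock map_bblock_inv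
      by (auto simp: b1_def b2'_def)
  next
    case 2
    have "count (mset \<nu>2) q1 = 0" using set\<nu>(2) 2 by (auto simp: count_eq_zero_iff)
    then have cnt: "count (mset \<mu>) q1 = count (mset \<nu>1) q1" by (simp add: mset\<mu>)
    have ge: "q1 \<le> x" if "x \<in> set \<mu>" for x using that 2 set\<nu> by (auto simp: set\<mu>)
    have le: "x \<le> q1 + 1" if "x \<in> set \<nu>1" for x using that set\<nu> by auto
    have eq1: "four_block_mat (l1 * tpow t \<nu>1 * l1') ?Y (0\<^sub>m m n) C2 = k1 * tpow t \<mu> * k2"
      unfolding C1[symmetric] by (rule eq)
    obtain Z where Z: "Z \<in> vmat v 0 n m" "?Y = C1 * Z"
      using block_quotient_left[OF eq1 C2c Yc l1(1,2) k12 len(1,3) set\<nu>(1) ge cnt] unfolding C1[symmetric] by blast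
    obtain C1' where C1': "C1' \<in> vmat v (- (q1 + 1)) n n" "C1 * C1' = 1\<^sub>m n" "C1' * C1 = 1\<^sub>m n"
      using elementary_inverse[OF l1(1,2) len(1) le C1] by blast
    note C1'c = vmat_carrier[OF C1'(1)] and Zc = vmat_carrier[OF Z(1)]
    \<comment> \<open>Dividing \<open>?Y = C1 * Z\<close> by \<open>C1\<close> on the left leaves
      \<open>\<sigma>(X)\<close> isolated; applying \<open>\<tau>\<close> recovers \<open>X\<close>
      and yields a congruence of the same shape for \<open>\<tau>\<close>.\<close>
    define \<tau> where "\<tau> = inv_into UNIV \<sigma>"
    interpret \<tau>: frobenius_field v t \<tau> unfolding \<tau>_def by (rule inverse_frobenius)
    have \<tau>\<sigma>: "map_mat \<tau> (map_mat \<sigma> Y) = Y" for Y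
      using bij_\<sigma> by (intro eq_matI) (auto simp: \<tau>_def bij_is_inj)
    let ?P = "map_mat \<tau> C1'" and ?Q = "map_mat \<tau> C2"
    let ?V = "C1' * ((- X) * C2)"
    have "C1' * ?Y = C1' * (C1 * map_mat \<sigma> X) + ?V"
      using C1c C2c C1'c X by (intro mult_add_distrib_mat[of _ n n _ m]) auto
    then have "Z = map_mat \<sigma> X + ?V"
      using C1c C1'c X Zc unfolding Z(2) by (simp add: cancel_left_mat[OF C1'(3), of _ m])
    then have "map_mat \<tau> Z = map_mat \<tau> (map_mat \<sigma> X) + map_mat \<tau> ?V"
      using C1'c C2c X by (intro eq_matI) (auto simp: \<tau>.\<sigma>_add \<tau>.\<sigma>.hom_minus \<tau>.\<sigma>.hom_uminus)
    moreover have "map_mat \<tau> ?V = - (?P * map_mat \<tau> X * ?Q)"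
    proof -
      have "map_mat \<tau> ?V = ?P * (map_mat \<tau> (- X) * ?Q)"
        using C1'c C2c X by (simp add: \<tau>.\<sigma>.mat_hom_mult[of _ n n _ m] \<tau>.\<sigma>.mat_hom_mult[of _ n m _ m]
            del: uminus_mult_left_mat uminus_mult_right_mat)
      also have "map_mat \<tau> (- X) = - map_mat \<tau> X" by (intro eq_matI) (auto simp: \<tau>.\<sigma>.hom_uminus)
      finally show ?thesis
        using C1'c C2c X by (simp add: assoc_mult_mat[of _ n n _ m _ m])
    qed
    ultimately have "X - ?P * map_mat \<tau> X * ?Q = map_mat \<tau> Z"
      unfolding \<tau>\<sigma> using C1'c C2c X by (intro eq_matI) auto
    then have XV: "X - ?P * map_mat \<tau> X * ?Q \<in> vmat v 0 n m" using \<tau>.map_vmat[OF Z(1)] by simp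
    \<comment> \<open>Applying \<open>\<tau>\<close> to the defining equations of \<open>C1\<close>
      and \<open>C2\<close> gives the intertwining relations for \<open>\<tau>\<close>.\<close>
    have "map_mat \<tau> (b1 * map_mat \<sigma> A) = map_mat \<tau> (A * C1)"
      "map_mat \<tau> (b2 * map_mat \<sigma> B) = map_mat \<tau> (B * C2)"
      using l1(3) l2(3) by (simp_all add: C1 C2)
    then have \<tau>A: "b1 * A = map_mat \<tau> A * map_mat \<tau> C1" and \<tau>B: "b2 * B = map_mat \<tau> B * ?Q"
      using A(1) B(1) bc C1c C2c \<tau>.map_bblock
      by (simp_all add: \<tau>.\<sigma>.mat_hom_mult[of _ n n _ n] \<tau>.\<sigma>.mat_hom_mult[of _ m m _ m] \<tau>\<sigma> b1_def b2_def)
    have CP: "map_mat \<tau> C1 * ?P = 1\<^sub>m n"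
      using \<tau>.\<sigma>.mat_hom_mult[OF C1c C1'c] C1'(2) by (simp add: \<tau>.\<sigma>.mat_hom_one)
    have "A * ?P = b1' * (b1 * A * ?P)"
      using A(1) bc C1'c by (simp add: assoc_mult_mat[of _ n n _ n _ n] cancel_left_mat[OF binv(1), of _ n])
    also have "b1 * A * ?P = map_mat \<tau> A"
      unfolding \<tau>A using A(1) C1c C1'c CP by (simp add: assoc_mult_mat[of _ n n _ n _ n])
    finally have AP: "A * ?P = b1' * map_mat \<tau> A" .
    have "(q1 + 1) * int n * int m \<le> q2 * int n * int m" using 2 by (intro mult_right_mono) auto
    moreover have "q2 * int m * int n < d2 * int n" using d2(1) n by (intro mult_strict_right_mono) auto
    moreover have "d1 * int m < (q1 + 1) * int n * int m" using d1(2) m by (intro mult_strict_right_mono) auto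
    ultimately have pos: "0 < - d1 * int m + d2 * int n" by (simp add: algebra_simps)
    \<comment> \<open>Now \<open>h = - (q1 + 1)\<close>: \<open>?P\<close> has denominator at most
      \<open>t^(q1+1)\<close>, and \<open>C2\<close> is divisible by \<open>t^q2\<close> with
      \<open>q2 \<ge> q1 + 1\<close>.\<close>
    have Q: "?Q \<in> vmat v (- (- (q1 + 1))) m m"
      unfolding minus_minus using 2 by (intro vmat_mono[OF \<tau>.map_vmat[OF C2v]]) simp
    show ?thesis
      using \<tau>.contraction_integral[OF A B bc(2) _ pow1(2) bc(3) _ pow2(1) \<tau>.map_vmat[OF C1'(1)] AP Q \<tau>B[symmetric] pos X XV]
        \<tau>.map_bblock \<tau>.map_bblock_inv
      by (auto simp: b1'_def b2_def)
  qed
qed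

section \<open>Coset invariance and the base point of the fiber\<close>

text \<open>The condition depends only on the coset \<open>gK\<close>: the outer factors become
  \<open>k^-1 k1\<close> and \<open>k2 \<sigma>(k)\<close>.\<close>

lemma ADLV_mult_Kgrp:
  assumes g: "ADLV v t \<sigma> N \<mu> b g" and k: "k \<in> Kgrp v N" and b: "b \<in> carrier_mat N N" and len: "length \<mu> = N"
  shows "ADLV v t \<sigma> N \<mu> b (g * k)"
proof -
  obtain k1 k2 where k12: "k1 \<in> Kgrp v N" "k2 \<in> Kgrp v N"
    and eq: "b * map_mat \<sigma> g = g * (k1 * tpow t \<mu> * k2)" and G: "g \<in> GLm N"
    using g by (auto simp: ADLV_def)
  obtain j where j: "j \<in> Kgrp v N" "k * j = 1\<^sub>m N" using Kgrp_inverse[OF k] by blast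
  have gc: "g \<in> carrier_mat N N" using G by (simp add: GLm_def)
  note car = gc b Kgrp_carrier[OF k] Kgrp_carrier[OF k12(1)] Kgrp_carrier[OF k12(2)] Kgrp_carrier[OF j(1)]
    tpow_carrier[OF len, of t] Kgrp_carrier[OF map_Kgrp[OF k]]
  note assocs = assoc_mult_mat[of _ N N _ N _ N]
  have "b * map_mat \<sigma> (g * k) = (b * map_mat \<sigma> g) * map_mat \<sigma> k"
    using car by (simp add: \<sigma>.mat_hom_mult[of _ N N _ N] assocs)
  also have "\<dots> = g * k * ((j * k1) * tpow t \<mu> * (k2 * map_mat \<sigma> k))"
    unfolding eq using car by (simp add: assocs cancel_left_mat[OF j(2), of _ N])
  finally have "b * map_mat \<sigma> (g * k) = g * k * ((j * k1) * tpow t \<mu> * (k2 * map_mat \<sigma> k))" .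
  moreover have "g * k \<in> GLm N"
    using G k car by (auto simp: GLm_def Kgrp_def det_mult[of _ N])
  ultimately show ?thesis
    unfolding ADLV_def using Kgrp_mult[OF j(1) k12(1)] Kgrp_mult[OF k12(2) map_Kgrp[OF k]] by blast
qed

text \<open>Shows that the fiber is nonempty. The two factorizations combine blockwise around the
  concatenated exponents, and the permutation matrices reordering these into \<open>\<mu>\<close>
  are absorbed into K.\<close>

lemma ADLV_blockdiag:
  assumes A: "ADLV v t \<sigma> n \<nu>1 b1 A" and B: "ADLV v t \<sigma> m \<nu>2 b2 B"
    and b: "b1 \<in> carrier_mat n n" "b2 \<in> carrier_mat m m"
    and len: "length \<nu>1 = n" "length \<nu>2 = m" and \<mu>: "mset \<mu> = mset (\<nu>1 @ \<nu>2)"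
  shows "ADLV v t \<sigma> (n + m) \<mu> (blockdiag b1 b2) (blockdiag A B)"
proof -
  let ?N = "n + m"
  obtain l1 l1' where l1: "l1 \<in> Kgrp v n" "l1' \<in> Kgrp v n"
    "b1 * map_mat \<sigma> A = A * (l1 * tpow t \<nu>1 * l1')" and AG: "A \<in> GLm n"
    using A by (auto simp: ADLV_def)
  obtain l2 l2' where l2: "l2 \<in> Kgrp v m" "l2' \<in> Kgrp v m"
    "b2 * map_mat \<sigma> B = B * (l2 * tpow t \<nu>2 * l2')" and BG: "B \<in> GLm m"
    using B by (auto simp: ADLV_def)
  have c: "A \<in> carrier_mat n n" "B \<in> carrier_mat m m" "det A \<noteq> 0" "det B \<noteq> 0"
    using AG BG by (auto simp: GLm_def)
  note lc = Kgrp_carrier[OF l1(1)] Kgrp_carrier[OF l1(2)] Kgrp_carrier[OF l2(1)] Kgrp_carrier[OF l2(2)]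
    tpow_carrier[OF len(1), of t] tpow_carrier[OF len(2), of t]
  have len\<mu>: "length \<mu> = ?N" using mset_eq_length[OF \<mu>] len by simp
  obtain p where p: "p permutes {..<?N}"
    and T: "tpow t (\<nu>1 @ \<nu>2) = perm_mat ?N p * tpow t \<mu> * transpose_mat (perm_mat ?N p)"
    using tpow_permute[OF \<mu>[symmetric], of t] len\<mu> by metis
  let ?L = "blockdiag l1 l2" and ?L' = "blockdiag l1' l2'" and ?P = "perm_mat ?N p :: 'a mat"
  have LK: "?L \<in> Kgrp v ?N" "?L' \<in> Kgrp v ?N" using l1 l2 by (auto intro: blockdiag_Kgrp)
  note PK = perm_mat_Kgrp[OF p]
  note car = Kgrp_carrier[OF LK(1)] Kgrp_carrier[OF LK(2)] Kgrp_carrier[OF PK(1)] Kgrp_carrier[OF PK(2)]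
    tpow_carrier[OF len\<mu>, of t]
  have "blockdiag b1 b2 * map_mat \<sigma> (blockdiag A B) = blockdiag (b1 * map_mat \<sigma> A) (b2 * map_mat \<sigma> B)"
    using c b by (simp add: map_blockdiag[of _ n _ m] blockdiag_mult[of _ n _ m])
  also have "\<dots> = blockdiag A B * (?L * blockdiag (tpow t \<nu>1) (tpow t \<nu>2) * ?L')"
    unfolding l1(3) l2(3) using c lc by (simp add: blockdiag_mult[of _ n _ m])
  also have "blockdiag (tpow t \<nu>1) (tpow t \<nu>2) = ?P * tpow t \<mu> * transpose_mat ?P"
    using T by (simp add: tpow_append)
  also have "?L * (?P * tpow t \<mu> * transpose_mat ?P) * ?L' = (?L * ?P) * tpow t \<mu> * (transpose_mat ?P * ?L')"
    using car by (intro mult_mat_regroup)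
  finally have "blockdiag b1 b2 * map_mat \<sigma> (blockdiag A B) =
    blockdiag A B * ((?L * ?P) * tpow t \<mu> * (transpose_mat ?P * ?L'))" .
  moreover have "det (blockdiag A B) = det A * det B"
    unfolding blockdiag_eq[OF c(1,2)] using c by (intro det_four_block_mat_lower_left_zero) auto
  then have "blockdiag A B \<in> GLm ?N" using c by (simp add: GLm_def)
  ultimately show ?thesis
    unfolding ADLV_def using Kgrp_mult[OF LK(1) PK(1)] Kgrp_mult[OF PK(2) LK(2)] by blast
qed

end

section \<open>The fiber as a single coset\<close>

lemma breve_setting_frobenius:
  assumes "breve_setting v t \<sigma> q"
  shows "frobenius_field v t \<sigma>"
  using assms by unfold_locales (auto simp: breve_setting_def)

theorem theorem3p9:
  fixes v :: "'a::field \<Rightarrow> int" and t :: 'a and \<sigma> :: "'a \<Rightarrow> 'a" and q :: nat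
    and n m :: nat and d1 d2 :: int and A B :: "'a mat"
  assumes setting: "breve_setting v t \<sigma> q"
    and n1: "1 \<le> n" and m1: "1 \<le> m"
    and gcd1: "gcd d1 (int n) = 1" and gcd2: "gcd d2 (int m) = 1"
    and p1pos: "0 < d1 mod int n" and p2pos: "0 < d2 mod int m"
    and drinfeld1: "d1 mod int n = 1 \<or> d1 mod int n = int n - 1"
    and drinfeld2: "d2 mod int m = 1 \<or> d2 mod int m = int m - 1"
    and qneq: "d1 div int n \<noteq> d2 div int m"
    and AX: "ADLV v t \<sigma> n (muBlock n d1) (bblock t n d1) A"
    and BX: "ADLV v t \<sigma> m (muBlock m d2) (bblock t m d2) B"
  shows "\<exists>g0. {g. ADLV v t \<sigma> (n + m) (rev (sort (muBlock n d1 @ muBlock m d2)))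
                    (blockdiag (bblock t n d1) (bblock t m d2)) g \<and>
                 (\<exists>k1\<in>Kgrp v n. \<exists>k2\<in>Kgrp v m. \<exists>X\<in>carrier_mat n m. \<exists>k\<in>Kgrp v (n + m).
                    g = blockdiag (A * k1) (B * k2) * unip n m X * k)}
             = {g0 * k | k. k \<in> Kgrp v (n + m)}"
  proof -
  interpret frobenius_field v t \<sigma> using setting by (rule breve_setting_frobenius)
  let ?\<mu> = "rev (sort (muBlock n d1 @ muBlock m d2))" and ?b = "blockdiag (bblock t n d1) (bblock t m d2)"
  let ?N = "n + m"
  have n: "0 < n" and m: "0 < m" using n1 m1 by auto
  have len: "length (muBlock n d1) = n" "length (muBlock m d2) = m" using n m by (auto simp: length_muBlock)
  have A: "A \<in> carrier_mat n n" and B: "B \<in> carrier_mat m m"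
    using AX BX by (auto simp: ADLV_def GLm_def)
  have base: "ADLV v t \<sigma> ?N ?\<mu> ?b (blockdiag A B)"
    using len by (intro ADLV_blockdiag[OF AX BX]) auto
  show ?thesis
  proof (intro exI[of _ "blockdiag A B"] equalityI subsetI, goal_cases)
    case (1 g)
    then obtain k1 k2 X k where G: "ADLV v t \<sigma> ?N ?\<mu> ?b g"
      and k12: "k1 \<in> Kgrp v n" "k2 \<in> Kgrp v m" and X: "X \<in> carrier_mat n m" and k: "k \<in> Kgrp v ?N"
      and g: "g = blockdiag (A * k1) (B * k2) * unip n m X * k" by blast
    \<comment> \<open>The decomposition may use another representative of the same Levi coset, so
      \<open>fiber_integral\<close> is applied to \<open>A * k1\<close> and
      \<open>B * k2\<close>.\<close>
    have "ADLV v t \<sigma> n (muBlock n d1) (bblock t n d1) (A * k1)" "ADLV v t \<sigma> m (muBlock m d2) (bblock t m d2) (B * k2)"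
      using ADLV_mult_Kgrp[OF AX k12(1)] ADLV_mult_Kgrp[OF BX k12(2)] len by auto
    then have "X \<in> vmat v 0 n m"
      using fiber_integral[OF n m p1pos p2pos qneq _ _ X k] G unfolding g by blast
    then have "blockdiag k1 k2 * unip n m X * k \<in> Kgrp v ?N"
      using k12 k by (intro Kgrp_mult blockdiag_Kgrp unip_Kgrp)
    moreover have "g = blockdiag A B * (blockdiag k1 k2 * unip n m X * k)"
    proof -
      note c = A B Kgrp_carrier[OF k12(1)] Kgrp_carrier[OF k12(2)]
      note car = blockdiag_carrier[OF c(1,2)] blockdiag_carrier[OF c(3,4)] unip_carrier[OF X] Kgrp_carrier[OF k]
      have "g = blockdiag A B * blockdiag k1 k2 * unip n m X * k"
        using c by (simp add: g blockdiag_mult[of _ n _ m])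
      also have "\<dots> = blockdiag A B * (blockdiag k1 k2 * unip n m X * k)"
        unfolding assoc_mult_mat[OF car(1,2,3)] by (rule assoc_mult_mat[OF car(1) mult_carrier_mat[OF car(2,3)] car(4)])
      finally show ?thesis .
    qed
    ultimately show ?case by blast
  next
    case (2 g)
    then obtain k where k: "k \<in> Kgrp v ?N" and g: "g = blockdiag A B * k" by blast
    have "ADLV v t \<sigma> ?N ?\<mu> ?b g"
      unfolding g using len by (intro ADLV_mult_Kgrp[OF base k]) auto
    \<comment> \<open>Conversely, the Iwasawa decomposition with trivial Levi correction and
      \<open>X = 0\<close> puts \<open>g\<close> over the coset of \<open>(A, B)\<close>.\<close>
    moreover have "g = blockdiag (A * 1\<^sub>m n) (B * 1\<^sub>m m) * unip n m (0\<^sub>m n m) * k"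
    proof -
      have "unip n m (0\<^sub>m n m) = (1\<^sub>m ?N :: 'a mat)" by (simp add: unip_def)
      moreover have "blockdiag A B * 1\<^sub>m ?N = blockdiag A B" by (rule right_mult_one_mat[OF blockdiag_carrier[OF A B]])
      ultimately show ?thesis using A B g by simp
    qed
    then have "\<exists>k1\<in>Kgrp v n. \<exists>k2\<in>Kgrp v m. \<exists>X\<in>carrier_mat n m. \<exists>k\<in>Kgrp v ?N.
        g = blockdiag (A * k1) (B * k2) * unip n m X * k"
      using k by (intro bexI[of _ "1\<^sub>m n"] bexI[of _ "1\<^sub>m m"] bexI[of _ "0\<^sub>m n m"] bexI[of _ k]) auto
    ultimately show ?case by blast
  qed
qed

end
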